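(* The $C^*$-algebra $q\mathbb{C}=\{f\in C_0((0,1],\mathbf{M}_2)\mid f(1)\text{ is diagonal}\}$ is universal in the category of all $C^*$-algebras for generators $h,k,x$ and relations $$hk=0,\qquad T(h,x,k)^2=T(h,x,k)^*=T(h,x,k).$$
   Context: $C_0((0,1],\mathbf{M}_2)$ is the algebra of continuous $\mathbf{M}_2(\mathbb{C})$-valued functions on $(0,1]$ vanishing at $0$. For a $C^*$-algebra $A$, $\tilde A$ denotes its unitization, where a new unit $\mathbb{1}$ is adjoined even if $A$ already has a unit. For $h,x,k\in A$, $$T(h,x,k)=\begin{bmatrix}\mathbb{1}-h & x^*\\ x & k\end{bmatrix}\in\mathbf{M}_2(\tilde A).$$ "$U$ is universal for generators $h,k,x$ and given relations" means: $U$ contains elements $h,k,x$ that satisfy the relations and generate $U$ as a $C^*$-algebra, and for any $C^*$-algebra $A$ and any $h',k',x'\in A$ satisfying the relations there is a unique $*$-homomorphism $U\to A$ with $h\mapsto h'$, $k\mapsto k'$, $x\mapsto x'$. The generators of $q\mathbb{C}$ are $h_0=t\otimes e_{11}$, $k_0=t\otimes e_{22}$, $x_0=\sqrt{t-t^2}\otimes e_{21}$, where $t$ is the coordinate function on $(0,1]$ and $e_{ij}$ are the matrix units. *)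

theory Defs
  imports "HOL-Analysis.Analysis"
begin

section \<open>C*-algebras\<close>

class star =
  fixes star :: "'a \<Rightarrow> 'a"

class scaleC =
  fixes scaleC :: "complex \<Rightarrow> 'a \<Rightarrow> 'a"

text \<open>No unit is required. The real scalar multiplication and the topology come from the
  superclasses; \<open>scaleR_scaleC\<close> ties the former to the complex scalar multiplication.\<close>

class cstar_algebra = real_normed_algebra + banach + scaleC + star +
  assumes scaleC_add_right: "scaleC c (x + y) = scaleC c x + scaleC c y"
    and scaleC_add_left: "scaleC (c + d) x = scaleC c x + scaleC d x"
    and scaleC_scaleC: "scaleC c (scaleC d x) = scaleC (c * d) x"
    and scaleR_scaleC: "scaleR r x = scaleC (complex_of_real r) x"
    and mult_scaleC_left: "scaleC c x * y = scaleC c (x * y)"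
    and mult_scaleC_right: "x * scaleC c y = scaleC c (x * y)"
    and norm_scaleC: "norm (scaleC c x) = cmod c * norm x"
    and star_star: "star (star x) = x"
    and star_add: "star (x + y) = star x + star y"
    and star_scaleC: "star (scaleC c x) = scaleC (cnj c) (star x)"
    and star_mult: "star (x * y) = star y * star x"
    and norm_star_mult: "norm (star x * x) = (norm x)\<^sup>2"

instantiation complex :: cstar_algebra
begin

definition star_complex :: "complex \<Rightarrow> complex" where
  "star_complex = cnj"

definition scaleC_complex :: "complex \<Rightarrow> complex \<Rightarrow> complex" where
  "scaleC_complex = (*)"

instance
  by standard
    (simp_all add: star_complex_def scaleC_complex_def algebra_simps norm_mult power2_eq_square
      scaleR_conv_of_real)

end

definition star_hom :: "('a::cstar_algebra \<Rightarrow> 'b::cstar_algebra) \<Rightarrow> bool" where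
  "star_hom \<phi> \<longleftrightarrow>
     (\<forall>x y. \<phi> (x + y) = \<phi> x + \<phi> y) \<and>
     (\<forall>c x. \<phi> (scaleC c x) = scaleC c (\<phi> x)) \<and>
     (\<forall>x y. \<phi> (x * y) = \<phi> x * \<phi> y) \<and>
     (\<forall>x. \<phi> (star x) = star (\<phi> x))"

definition cstar_subalgebra :: "'a::cstar_algebra set \<Rightarrow> bool" where
  "cstar_subalgebra S \<longleftrightarrow>
     closed S \<and> 0 \<in> S \<and>
     (\<forall>x\<in>S. \<forall>y\<in>S. x + y \<in> S) \<and>
     (\<forall>c. \<forall>x\<in>S. scaleC c x \<in> S) \<and>
     (\<forall>x\<in>S. \<forall>y\<in>S. x * y \<in> S) \<and>
     (\<forall>x\<in>S. star x \<in> S)"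

definition cstar_generated :: "'a::cstar_algebra set \<Rightarrow> 'a set" where
  "cstar_generated X = cstar_subalgebra hull X"


section \<open>The unitization\<close>

text \<open>\<open>Unitized a c\<close> stands for \<open>a + c\<close> times the adjoined unit; a new unit is adjoined whether or
  not the algebra already has one. Only the \<open>*\<close>-algebra structure is set up here: the
  relations considered below are purely algebraic, so the C*-norm is not needed.\<close>

datatype 'a unitization = Unitized (elem_part: 'a) (scalar_part: complex)

instantiation unitization :: (cstar_algebra) "{ring_1, star}"
begin

definition zero_unitization :: "'a unitization" where
  "0 = Unitized 0 0"

definition one_unitization :: "'a unitization" where
  "1 = Unitized 0 1"

definition plus_unitization :: "'a unitization \<Rightarrow> 'a unitization \<Rightarrow> 'a unitization" where
  "u + v = Unitized (elem_part u + elem_part v) (scalar_part u + scalar_part v)"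

definition uminus_unitization :: "'a unitization \<Rightarrow> 'a unitization" where
  "- u = Unitized (- elem_part u) (- scalar_part u)"

definition minus_unitization :: "'a unitization \<Rightarrow> 'a unitization \<Rightarrow> 'a unitization" where
  "u - v = Unitized (elem_part u - elem_part v) (scalar_part u - scalar_part v)"

definition times_unitization :: "'a unitization \<Rightarrow> 'a unitization \<Rightarrow> 'a unitization" where
  "u * v = Unitized
     (elem_part u * elem_part v + scaleC (scalar_part u) (elem_part v)
        + scaleC (scalar_part v) (elem_part u))
     (scalar_part u * scalar_part v)"

definition star_unitization :: "'a unitization \<Rightarrow> 'a unitization" where
  "star u = Unitized (star (elem_part u)) (cnj (scalar_part u))"

lemma scaleC_one_eq: "scaleC 1 x = (x::'a::cstar_algebra)"
  using scaleR_scaleC[of 1 x] by simp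

lemma scaleC_zero_left_eq: "scaleC 0 x = (0::'a::cstar_algebra)"
  using scaleR_scaleC[of 0 x] by simp

lemma scaleC_zero_right_eq: "scaleC c 0 = (0::'a::cstar_algebra)"
  using scaleC_add_right[of c "0::'a" 0] by simp

instance
  by standard
    (simp_all add: zero_unitization_def one_unitization_def plus_unitization_def
      uminus_unitization_def minus_unitization_def times_unitization_def
      scaleC_one_eq scaleC_zero_left_eq scaleC_zero_right_eq scaleC_add_right scaleC_add_left
      scaleC_scaleC mult_scaleC_left mult_scaleC_right algebra_simps)

end

definition embed :: "'a \<Rightarrow> 'a unitization" where
  "embed a = Unitized a 0"


section \<open>Matrices and the relations\<close>

definition mat_star :: "'a::star ^ 'n ^ 'm \<Rightarrow> 'a ^ 'm ^ 'n" where
  "mat_star m = (\<chi> i j. star (m $ j $ i))"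

definition T :: "'a::cstar_algebra \<Rightarrow> 'a \<Rightarrow> 'a \<Rightarrow> 'a unitization ^ 2 ^ 2" where
  "T h x k = vector [vector [1 - embed h, embed (star x)],
                     vector [embed x,     embed k       ]]"

definition relations :: "'a::cstar_algebra \<Rightarrow> 'a \<Rightarrow> 'a \<Rightarrow> bool" where
  "relations h k x \<longleftrightarrow>
     h * k = 0 \<and>
     T h x k ** T h x k = mat_star (T h x k) \<and>
     mat_star (T h x k) = T h x k"


section \<open>The C*-algebra $q\mathbb{C}$\<close>

type_synonym M2 = "complex ^ 2 ^ 2"

text \<open>The C*-norm on the matrices is the operator norm for the Euclidean norm on \<open>complex ^ 2\<close>; it
  is not the norm which the library puts on the type \<open>complex ^ 2 ^ 2\<close>. The two are
  equivalent, so continuity and limits may refer to the latter.\<close>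

definition opnorm :: "M2 \<Rightarrow> real" where
  "opnorm m = onorm (\<lambda>v. m *v v)"

definition mat_scale :: "complex \<Rightarrow> M2 \<Rightarrow> M2" where
  "mat_scale c m = (\<chi> i j. c * m $ i $ j)"

definition mat_unit :: "2 \<Rightarrow> 2 \<Rightarrow> M2" where
  "mat_unit a b = (\<chi> i j. if i = a \<and> j = b then 1 else 0)"

definition diagonal :: "M2 \<Rightarrow> bool" where
  "diagonal m \<longleftrightarrow> (\<forall>i j. i \<noteq> j \<longrightarrow> m $ i $ j = 0)"

text \<open>A function on \<open>{0<..1}\<close> is encoded as a function on all reals which is \<open>0\<close> elsewhere.\<close>

definition C0_M2 :: "(real \<Rightarrow> M2) set" where
  "C0_M2 = {f. continuous_on {0<..1} f \<and> (f \<longlongrightarrow> 0) (at_right 0) \<and> (\<forall>t. t \<notin> {0<..1} \<longrightarrow> f t = 0)}"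

typedef qC = "{f \<in> C0_M2. diagonal (f 1)}"
  morphisms qC_fun Abs_qC
  by (intro exI[of _ "\<lambda>_. 0"]) (simp add: C0_M2_def diagonal_def)

setup_lifting type_definition_qC

lemma diagonal_closed:
  "diagonal 0"
  "diagonal m \<Longrightarrow> diagonal n \<Longrightarrow> diagonal (m + n)"
  "diagonal m \<Longrightarrow> diagonal n \<Longrightarrow> diagonal (m - n)"
  "diagonal m \<Longrightarrow> diagonal (- m)"
  "diagonal m \<Longrightarrow> diagonal n \<Longrightarrow> diagonal (m ** n)"
  "diagonal m \<Longrightarrow> diagonal (mat_scale c m)"
  "diagonal m \<Longrightarrow> diagonal (mat_star m)"
  "diagonal m \<Longrightarrow> diagonal (r *\<^sub>R m)"
  by (simp_all add: diagonal_def forall_2 matrix_matrix_mult_def mat_scale_def mat_star_def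
      star_complex_def sum_2)

lemma matrix_mult_component:
  "((m::M2) ** n) $ i $ j = m $ i $ 1 * n $ 1 $ j + m $ i $ 2 * n $ 2 $ j"
  by (simp add: matrix_matrix_mult_def sum_2)

lemma M2_tendstoI:
  fixes f :: "real \<Rightarrow> M2"
  assumes "\<And>i j. ((\<lambda>t. f t $ i $ j) \<longlongrightarrow> l $ i $ j) F"
  shows "(f \<longlongrightarrow> l) F"
  using assms by (intro vec_tendstoI)

lemma C0_M2_lift:
  fixes G :: "M2 \<Rightarrow> M2 \<Rightarrow> M2"
  assumes f: "f \<in> C0_M2" and g: "g \<in> C0_M2" and G0: "G 0 0 = 0"
    and lim: "\<And>a b F. (f \<longlongrightarrow> a) F \<Longrightarrow> (g \<longlongrightarrow> b) F \<Longrightarrow> ((\<lambda>t. G (f t) (g t)) \<longlongrightarrow> G a b) F"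
  shows "(\<lambda>t. G (f t) (g t)) \<in> C0_M2"
proof -
  have "continuous_on {0<..1} (\<lambda>t. G (f t) (g t))"
    using f g lim unfolding C0_M2_def continuous_on_def by blast
  moreover have "((\<lambda>t. G (f t) (g t)) \<longlongrightarrow> 0) (at_right 0)"
    using f g lim[of 0 "at_right 0" 0] by (simp add: C0_M2_def G0)
  moreover have "G (f t) (g t) = 0" if "t \<notin> {0<..1}" for t
    using f g that G0 unfolding C0_M2_def by (metis (mono_tags, lifting) mem_Collect_eq)
  ultimately show ?thesis
    by (simp add: C0_M2_def)
qed

lemma C0_M2_closed:
  "(\<lambda>_. 0) \<in> C0_M2"
  "f \<in> C0_M2 \<Longrightarrow> g \<in> C0_M2 \<Longrightarrow> (\<lambda>t. f t + g t) \<in> C0_M2"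
  "f \<in> C0_M2 \<Longrightarrow> g \<in> C0_M2 \<Longrightarrow> (\<lambda>t. f t - g t) \<in> C0_M2"
  "f \<in> C0_M2 \<Longrightarrow> (\<lambda>t. - f t) \<in> C0_M2"
  "f \<in> C0_M2 \<Longrightarrow> (\<lambda>t. r *\<^sub>R f t) \<in> C0_M2"
  "f \<in> C0_M2 \<Longrightarrow> (\<lambda>t. mat_scale c (f t)) \<in> C0_M2"
  "f \<in> C0_M2 \<Longrightarrow> (\<lambda>t. mat_star (f t)) \<in> C0_M2"
  "f \<in> C0_M2 \<Longrightarrow> g \<in> C0_M2 \<Longrightarrow> (\<lambda>t. f t ** g t) \<in> C0_M2"
proof -
  show "(\<lambda>_. 0) \<in> C0_M2"
    by (simp add: C0_M2_def)
  show "f \<in> C0_M2 \<Longrightarrow> g \<in> C0_M2 \<Longrightarrow> (\<lambda>t. f t + g t) \<in> C0_M2"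
    by (rule C0_M2_lift[where G = "\<lambda>a b. a + b"]) (simp_all add: tendsto_add)
  show "f \<in> C0_M2 \<Longrightarrow> g \<in> C0_M2 \<Longrightarrow> (\<lambda>t. f t - g t) \<in> C0_M2"
    by (rule C0_M2_lift[where G = "\<lambda>a b. a - b"]) (simp_all add: tendsto_diff)
  show "f \<in> C0_M2 \<Longrightarrow> (\<lambda>t. - f t) \<in> C0_M2"
    by (rule C0_M2_lift[where G = "\<lambda>a b. - a" and g = f]) (simp_all add: tendsto_minus)
  show "f \<in> C0_M2 \<Longrightarrow> (\<lambda>t. r *\<^sub>R f t) \<in> C0_M2"
    by (rule C0_M2_lift[where G = "\<lambda>a b. r *\<^sub>R a" and g = f]) (simp_all add: tendsto_scaleR)
  show "f \<in> C0_M2 \<Longrightarrow> (\<lambda>t. mat_scale c (f t)) \<in> C0_M2"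
    by (rule C0_M2_lift[where G = "\<lambda>a b. mat_scale c a" and g = f])
      (simp_all add: mat_scale_def vec_eq_iff M2_tendstoI tendsto_mult_left tendsto_vec_nth)
  show "f \<in> C0_M2 \<Longrightarrow> (\<lambda>t. mat_star (f t)) \<in> C0_M2"
    by (rule C0_M2_lift[where G = "\<lambda>a b. mat_star a" and g = f])
      (simp_all add: mat_star_def star_complex_def vec_eq_iff M2_tendstoI tendsto_cnj tendsto_vec_nth)
  show "f \<in> C0_M2 \<Longrightarrow> g \<in> C0_M2 \<Longrightarrow> (\<lambda>t. f t ** g t) \<in> C0_M2"
    by (rule C0_M2_lift[where G = "\<lambda>a b. a ** b"])
      (simp_all add: matrix_mult_component vec_eq_iff M2_tendstoI tendsto_add tendsto_mult
        tendsto_vec_nth)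
qed

lemma opnorm_bound: "norm (m *v v) \<le> opnorm m * norm v"
  unfolding opnorm_def by (rule onorm) simp

lemma opnorm_le: "(\<And>v. norm (m *v v) \<le> b * norm v) \<Longrightarrow> opnorm m \<le> b"
  unfolding opnorm_def by (rule onorm_le)

lemma opnorm_nonneg: "0 \<le> opnorm m"
  unfolding opnorm_def by (rule onorm_pos_le) simp

lemma opnorm_0: "opnorm 0 = 0"
  using opnorm_le[of 0 0] opnorm_nonneg[of 0] by simp

lemma opnorm_triangle: "opnorm (m + n) \<le> opnorm m + opnorm n"
  unfolding opnorm_def matrix_vector_mult_add_rdistrib by (rule onorm_triangle) simp_all

lemma opnorm_mult: "opnorm (m ** n) \<le> opnorm m * opnorm n"
proof (rule opnorm_le)
  fix v
  have "norm ((m ** n) *v v) \<le> opnorm m * norm (n *v v)"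
    by (simp flip: matrix_vector_mul_assoc add: opnorm_bound)
  also have "\<dots> \<le> opnorm m * (opnorm n * norm v)"
    by (intro mult_left_mono opnorm_bound opnorm_nonneg)
  finally show "norm ((m ** n) *v v) \<le> opnorm m * opnorm n * norm v"
    by (simp add: mult.assoc)
qed

lemma opnorm_scale_le: "opnorm (mat_scale c m) \<le> cmod c * opnorm m"
proof (rule opnorm_le)
  fix v
  have eq: "mat_scale c m *v v = (\<chi> i. c * (m *v v) $ i)"
    by (simp add: vec_eq_iff mat_scale_def matrix_vector_mult_def sum_2 algebra_simps)
  have "norm (mat_scale c m *v v) = cmod c * norm (m *v v)"
    unfolding eq by (simp add: norm_vec_def L2_set_def norm_mult power_mult_distrib
        real_sqrt_mult flip: sum_distrib_left)
  also have "\<dots> \<le> cmod c * (opnorm m * norm v)"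
    by (intro mult_left_mono opnorm_bound) simp
  finally show "norm (mat_scale c m *v v) \<le> cmod c * opnorm m * norm v"
    by (simp add: mult.assoc)
qed

lemma opnorm_scale: "opnorm (mat_scale c m) = cmod c * opnorm m"
proof (cases "c = 0")
  case True
  then show ?thesis
    using opnorm_scale_le[of c m] opnorm_nonneg[of "mat_scale c m"] by simp
next
  case False
  have "opnorm m = opnorm (mat_scale (inverse c) (mat_scale c m))"
    using False by (simp add: mat_scale_def vec_eq_iff flip: mult.assoc)
  also have "\<dots> \<le> cmod (inverse c) * opnorm (mat_scale c m)"
    by (rule opnorm_scale_le)
  finally have "cmod c * opnorm m \<le> opnorm (mat_scale c m)"
    using False by (simp add: norm_inverse norm_divide field_simps)
  with opnorm_scale_le[of c m] show ?thesis
    by simp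
qed

lemma inner_mat_star: "(m *v v) \<bullet> w = v \<bullet> (mat_star m *v w)" for m :: M2
  by (simp add: inner_vec_def matrix_vector_mult_def sum_2 mat_star_def star_complex_def
      inner_complex_def algebra_simps)

lemma mat_star_mat_star: "mat_star (mat_star m) = m" for m :: M2
  by (simp add: mat_star_def star_complex_def vec_eq_iff)

lemma opnorm_star_mult: "opnorm (mat_star m ** m) = (opnorm m)\<^sup>2"
proof -
  have le: "(opnorm n)\<^sup>2 \<le> opnorm (mat_star n ** n)" for n
  proof -
    have "norm (n *v v) \<le> sqrt (opnorm (mat_star n ** n)) * norm v" for v
    proof -
      have "(norm (n *v v))\<^sup>2 = v \<bullet> ((mat_star n ** n) *v v)"
        by (simp add: power2_norm_eq_inner inner_mat_star flip: matrix_vector_mul_assoc)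
      also have "\<dots> \<le> norm v * norm ((mat_star n ** n) *v v)"
        by (rule norm_cauchy_schwarz)
      also have "\<dots> \<le> norm v * (opnorm (mat_star n ** n) * norm v)"
        by (intro mult_left_mono opnorm_bound) simp
      finally have "(norm (n *v v))\<^sup>2 \<le> opnorm (mat_star n ** n) * (norm v)\<^sup>2"
        by (simp add: power2_eq_square algebra_simps)
      then have "sqrt ((norm (n *v v))\<^sup>2) \<le> sqrt (opnorm (mat_star n ** n) * (norm v)\<^sup>2)"
        by (rule real_sqrt_le_mono)
      then show ?thesis
        by (simp add: real_sqrt_mult)
    qed
    then have "opnorm n \<le> sqrt (opnorm (mat_star n ** n))"
      by (rule opnorm_le)
    then show ?thesis
      using opnorm_nonneg real_le_rsqrt sqrt_ge_absD by (metis abs_of_nonneg)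
  qed
  have ge: "opnorm n \<le> opnorm (mat_star n)" for n
  proof (cases "opnorm n = 0")
    case False
    have "opnorm n * opnorm n \<le> opnorm (mat_star n) * opnorm n"
      using le[of n] opnorm_mult[of "mat_star n" n] by (simp add: power2_eq_square)
    then show ?thesis
      using False opnorm_nonneg[of n] by simp
  qed (simp add: opnorm_nonneg)
  have "opnorm (mat_star m) = opnorm m"
    using ge[of m] ge[of "mat_star m"] by (simp add: mat_star_mat_star)
  then show ?thesis
    using le[of m] opnorm_mult[of "mat_star m" m] by (simp add: power2_eq_square)
qed

lemma norm_le_opnorm: "norm m \<le> 4 * opnorm m"
proof -
  have entry: "norm (m $ i $ j) \<le> opnorm m" for i j
  proof -
    have "m $ i $ j = (m *v axis j 1) $ i"
      by (simp add: matrix_vector_mult_def axis_def if_distrib cong: if_cong)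
    also have "norm \<dots> \<le> norm (m *v axis j 1)"
      by (rule Finite_Cartesian_Product.norm_nth_le)
    also have "\<dots> \<le> opnorm m"
      using opnorm_bound[of m "axis j 1"] by (simp add: norm_axis_1)
    finally show ?thesis .
  qed
  have row: "norm (m $ i) \<le> norm (m $ i $ 1) + norm (m $ i $ 2)" for i
    using L2_set_le_sum[of UNIV "\<lambda>j. norm (m $ i $ j)"] by (simp add: norm_vec_def sum_2)
  have "norm m \<le> norm (m $ 1) + norm (m $ 2)"
    using L2_set_le_sum[of UNIV "\<lambda>i. norm (m $ i)"] by (simp add: norm_vec_def[of m] sum_2)
  then show ?thesis
    using row[of 1] row[of 2] entry[of 1 1] entry[of 1 2] entry[of 2 1] entry[of 2 2] by linarith
qed

lemma opnorm_le_norm: "opnorm m \<le> 4 * norm m"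
proof (rule opnorm_le)
  fix v :: "complex ^ 2"
  have entry: "norm (m $ i $ j * v $ j) \<le> norm m * norm v" for i j
    unfolding norm_mult
    using Finite_Cartesian_Product.norm_nth_le[of m i] Finite_Cartesian_Product.norm_nth_le[of "m $ i" j]
      Finite_Cartesian_Product.norm_nth_le[of v j]
    by (intro mult_mono) simp_all
  have row: "norm ((m *v v) $ i) \<le> 2 * (norm m * norm v)" for i
    using norm_triangle_ineq[of "m $ i $ 1 * v $ 1" "m $ i $ 2 * v $ 2"] entry[of i 1] entry[of i 2]
    by (simp add: matrix_vector_mult_def sum_2)
  have "norm (m *v v) \<le> norm ((m *v v) $ 1) + norm ((m *v v) $ 2)"
    using L2_set_le_sum[of UNIV "\<lambda>i. norm ((m *v v) $ i)"]
    by (simp add: norm_vec_def[of "m *v v"] sum_2)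
  then show "norm (m *v v) \<le> 4 * norm m * norm v"
    using row[of 1] row[of 2] by simp
qed

lemma C0_M2_continuous_Icc:
  assumes "f 0 = 0"
  shows "continuous_on {0<..1} f \<and> (f \<longlongrightarrow> 0) (at_right 0) \<longleftrightarrow>
         continuous_on {0..1} (f :: real \<Rightarrow> M2)"
proof -
  have at: "at t within {0<..1} = at t within {0..1}" if "t \<in> {0<..1}" for t :: real
    using that by (intro at_within_nhd[of t "{0<..}"]) auto
  have at0: "at 0 within {0..1} = at_right (0::real)"
    by (rule at_within_Icc_at_right) simp
  have "{0..1} = insert (0::real) {0<..1}"
    by auto
  then show ?thesis
    using at at0 assms by (auto simp: continuous_on_def)
qed

lemma C0_M2_bdd: "f \<in> C0_M2 \<Longrightarrow> bdd_above ((\<lambda>t. opnorm (f t)) ` {0<..1})"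
proof -
  assume f: "f \<in> C0_M2"
  then have "continuous_on {0..1} f"
    using C0_M2_continuous_Icc[of f] by (simp add: C0_M2_def)
  then have "bounded (f ` {0..1})"
    by (intro compact_imp_bounded compact_continuous_image) simp_all
  then obtain B where B: "norm (f t) \<le> B" if "t \<in> {0..1}" for t
    unfolding bounded_iff by (metis imageI)
  show ?thesis
  proof (rule bdd_aboveI2)
    fix t :: real
    assume "t \<in> {0<..1}"
    then show "opnorm (f t) \<le> 4 * B"
      using B[of t] opnorm_le_norm[of "f t"] by simp
  qed
qed

instantiation qC :: "{real_normed_algebra, scaleC, star}"
begin

lift_definition zero_qC :: qC is "\<lambda>_. 0"
  by (simp add: C0_M2_closed diagonal_closed)

lift_definition plus_qC :: "qC \<Rightarrow> qC \<Rightarrow> qC" is "\<lambda>f g t. f t + g t"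
  by (simp add: C0_M2_closed diagonal_closed)

lift_definition minus_qC :: "qC \<Rightarrow> qC \<Rightarrow> qC" is "\<lambda>f g t. f t - g t"
  by (simp add: C0_M2_closed diagonal_closed)

lift_definition uminus_qC :: "qC \<Rightarrow> qC" is "\<lambda>f t. - f t"
  by (simp add: C0_M2_closed diagonal_closed)

lift_definition times_qC :: "qC \<Rightarrow> qC \<Rightarrow> qC" is "\<lambda>f g t. f t ** g t"
  by (simp add: C0_M2_closed diagonal_closed)

lift_definition scaleR_qC :: "real \<Rightarrow> qC \<Rightarrow> qC" is "\<lambda>r f t. r *\<^sub>R f t"
  by (simp add: C0_M2_closed diagonal_closed)

lift_definition scaleC_qC :: "complex \<Rightarrow> qC \<Rightarrow> qC" is "\<lambda>c f t. mat_scale c (f t)"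
  by (simp add: C0_M2_closed diagonal_closed)

lift_definition star_qC :: "qC \<Rightarrow> qC" is "\<lambda>f t. mat_star (f t)"
  by (simp add: C0_M2_closed diagonal_closed)

definition norm_qC :: "qC \<Rightarrow> real" where
  "norm_qC f = (SUP t\<in>{0<..1}. opnorm (qC_fun f t))"

definition dist_qC :: "qC \<Rightarrow> qC \<Rightarrow> real" where
  "dist_qC f g = norm (f - g)"

definition sgn_qC :: "qC \<Rightarrow> qC" where
  "sgn_qC f = inverse (norm f) *\<^sub>R f"

definition uniformity_qC :: "(qC \<times> qC) filter" where
  "uniformity_qC = (INF e\<in>{0<..}. principal {(f, g). dist f g < e})"

definition open_qC :: "qC set \<Rightarrow> bool" where
  "open_qC U \<longleftrightarrow> (\<forall>f\<in>U. eventually (\<lambda>(f', g). f' = f \<longrightarrow> g \<in> U) uniformity)"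

lemmas qC_ops = zero_qC.rep_eq plus_qC.rep_eq minus_qC.rep_eq uminus_qC.rep_eq times_qC.rep_eq
  scaleR_qC.rep_eq scaleC_qC.rep_eq star_qC.rep_eq

lemma qC_eqI: "(\<And>t i j. qC_fun f t $ i $ j = qC_fun g t $ i $ j) \<Longrightarrow> f = g"
  by (simp add: vec_eq_iff fun_eq_iff flip: qC_fun_inject)

lemma qC_outside: "t \<notin> {0<..1} \<Longrightarrow> qC_fun f t = 0"
  using qC_fun[of f] by (simp add: C0_M2_def)

lemma opnorm_le_norm_qC: "opnorm (qC_fun f t) \<le> norm f"
proof -
  have bdd: "bdd_above ((\<lambda>t. opnorm (qC_fun f t)) ` {0<..1})"
    using qC_fun[of f] by (intro C0_M2_bdd) simp
  have le: "opnorm (qC_fun f t) \<le> norm f" if "t \<in> {0<..1}" for t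
    unfolding norm_qC_def by (rule cSUP_upper[OF that bdd])
  have "0 \<le> norm f"
    using le[of 1] opnorm_nonneg[of "qC_fun f 1"] by simp
  then show ?thesis
    using le[of t] by (cases "t \<in> {0<..1}") (simp_all add: qC_outside opnorm_0)
qed

lemma norm_qC_le: "(\<And>t. opnorm (qC_fun f t) \<le> b) \<Longrightarrow> norm f \<le> b"
  unfolding norm_qC_def by (rule cSUP_least) auto

lemma norm_qC_nonneg: "0 \<le> norm (f::qC)"
  using opnorm_le_norm_qC[of f 0] opnorm_nonneg[of "qC_fun f 0"] by simp

lemma norm_scaleC_qC: "norm (scaleC c f) = cmod c * norm (f::qC)"
proof -
  have le: "norm (scaleC c f) \<le> cmod c * norm (f::qC)" for c f
    by (rule norm_qC_le) (simp add: qC_ops opnorm_scale mult_left_mono opnorm_le_norm_qC)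
  show ?thesis
  proof (cases "c = 0")
    case True
    then show ?thesis
      using le[of c f] norm_qC_nonneg[of "scaleC c f"] by simp
  next
    case False
    have "f = scaleC (inverse c) (scaleC c f)"
      using False by (intro qC_eqI) (simp add: qC_ops mat_scale_def flip: mult.assoc)
    then have "norm f \<le> cmod (inverse c) * norm (scaleC c f)"
      using le[of "inverse c" "scaleC c f"] by simp
    then have "cmod c * norm f \<le> norm (scaleC c f)"
      using False by (simp add: norm_inverse norm_divide field_simps)
    with le[of c f] show ?thesis
      by simp
  qed
qed

lemma scaleR_scaleC_qC: "r *\<^sub>R f = scaleC (complex_of_real r) (f::qC)"
  by (rule qC_eqI) (simp add: qC_ops mat_scale_def scaleR_conv_of_real[where 'a = complex])

lemma norm_star_mult_qC: "norm (star f * f) = (norm (f::qC))\<^sup>2"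
proof (rule antisym)
  show "norm (star f * f) \<le> (norm f)\<^sup>2"
    by (rule norm_qC_le)
      (simp add: qC_ops opnorm_star_mult power_mono opnorm_le_norm_qC opnorm_nonneg)
  have "norm f \<le> sqrt (norm (star f * f))"
  proof (rule norm_qC_le)
    fix t
    have "(opnorm (qC_fun f t))\<^sup>2 \<le> norm (star f * f)"
      using opnorm_le_norm_qC[of "star f * f" t] by (simp add: qC_ops opnorm_star_mult)
    then show "opnorm (qC_fun f t) \<le> sqrt (norm (star f * f))"
      by (rule real_le_rsqrt)
  qed
  then have "(norm f)\<^sup>2 \<le> (sqrt (norm (star f * f)))\<^sup>2"
    by (intro power_mono norm_qC_nonneg)
  then show "(norm f)\<^sup>2 \<le> norm (star f * f)"
    by (simp add: norm_qC_nonneg)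
qed

instance
proof
  fix f g h :: qC and r s :: real
  show "f + g + h = f + (g + h)" "f + g = g + f" "0 + f = f" "- f + f = 0" "f - g = f + - g"
    "r *\<^sub>R (f + g) = r *\<^sub>R f + r *\<^sub>R g" "(r + s) *\<^sub>R f = r *\<^sub>R f + s *\<^sub>R f"
    "r *\<^sub>R s *\<^sub>R f = (r * s) *\<^sub>R f" "1 *\<^sub>R f = f"
    "f * g * h = f * (g * h)" "(f + g) * h = f * h + g * h" "f * (g + h) = f * g + f * h"
    "r *\<^sub>R f * g = r *\<^sub>R (f * g)" "f * r *\<^sub>R g = r *\<^sub>R (f * g)"
    by (rule qC_eqI; simp add: qC_ops matrix_mult_component algebra_simps)+
  show "dist f g = norm (f - g)" "sgn f = inverse (norm f) *\<^sub>R f"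
    by (simp_all add: dist_qC_def sgn_qC_def)
  show "(uniformity :: (qC \<times> qC) filter) = (INF e\<in>{0<..}. principal {(f, g). dist f g < e})"
    by (rule uniformity_qC_def)
  show "open U \<longleftrightarrow> (\<forall>f\<in>U. \<forall>\<^sub>F (f', g) in uniformity. f' = f \<longrightarrow> g \<in> U)" for U :: "qC set"
    by (rule open_qC_def)
  show "norm (r *\<^sub>R f) = \<bar>r\<bar> * norm f"
    by (simp add: scaleR_scaleC_qC norm_scaleC_qC)
  show "norm (f + g) \<le> norm f + norm g"
    by (rule norm_qC_le)
      (simp add: qC_ops order_trans[OF opnorm_triangle] add_mono opnorm_le_norm_qC)
  show "norm (f * g) \<le> norm f * norm g"
    by (rule norm_qC_le)
      (simp add: qC_ops order_trans[OF opnorm_mult] mult_mono opnorm_le_norm_qC opnorm_nonneg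
        norm_qC_nonneg)
  show "norm f = 0 \<longleftrightarrow> f = 0"
  proof
    assume "norm f = 0"
    have "norm (qC_fun f t) \<le> 0" for t
      using norm_le_opnorm[of "qC_fun f t"] opnorm_le_norm_qC[of f t] \<open>norm f = 0\<close> by linarith
    then show "f = 0"
      by (intro qC_eqI) (simp add: qC_ops)
  next
    assume "f = 0"
    then show "norm f = 0"
      using norm_qC_le[of f 0] norm_qC_nonneg[of f] by (simp add: qC_ops opnorm_0)
  qed
qed

end

lemma complete_qC:
  fixes X :: "nat \<Rightarrow> qC"
  assumes X: "\<And>e. e > 0 \<Longrightarrow> \<exists>M. \<forall>m\<ge>M. \<forall>n\<ge>M. norm (X m - X n) < e"
  shows "\<exists>f. \<forall>e>0. \<exists>N. \<forall>n\<ge>N. norm (X n - f) < e"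
proof -
  define F where "F n = qC_fun (X n)" for n
  have F: "F n \<in> C0_M2" "diagonal (F n 1)" for n
    using qC_fun[of "X n"] by (simp_all add: F_def)
  have "uniformly_convergent_on UNIV F"
  proof (rule Cauchy_uniformly_convergent, rule uniformly_Cauchy_onI)
    fix e :: real
    assume "e > 0"
    with X[of "e / 4"] obtain M where M: "norm (X m - X n) < e / 4" if "m \<ge> M" "n \<ge> M" for m n
      by auto
    have "dist (F m t) (F n t) < e" if "m \<ge> M" "n \<ge> M" for m n t
    proof -
      have "dist (F m t) (F n t) \<le> 4 * opnorm (qC_fun (X m - X n) t)"
        using norm_le_opnorm[of "F m t - F n t"] by (simp add: dist_norm F_def qC_ops)
      also have "\<dots> \<le> 4 * norm (X m - X n)"
        using opnorm_le_norm_qC[of "X m - X n" t] by simp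
      finally show ?thesis
        using M[OF that] by simp
    qed
    then show "\<exists>M. \<forall>t\<in>UNIV. \<forall>m\<ge>M. \<forall>n\<ge>M. dist (F m t) (F n t) < e"
      by blast
  qed
  then obtain g where g: "uniform_limit UNIV F g sequentially"
    by (auto simp: uniformly_convergent_on_def)
  have lim: "(\<lambda>n. F n t) \<longlonglongrightarrow> g t" for t
    using tendsto_uniform_limitI[OF g] by simp
  have out: "g t = 0" if "t \<notin> {0<..1}" for t
  proof -
    have "F n t = 0" for n
      using F[of n] that unfolding C0_M2_def by blast
    with lim[of t] show ?thesis
      by (simp add: LIMSEQ_const_iff)
  qed
  have "continuous_on {0..1} g"
  proof (rule uniform_limit_theorem)
    have "F n 0 = 0" for n
      using F[of n] by (simp add: C0_M2_def)
    then show "\<forall>\<^sub>F n in sequentially. continuous_on {0..1} (F n)"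
      using F(1) C0_M2_continuous_Icc by (auto simp: C0_M2_def intro!: always_eventually)
    show "uniform_limit {0..1} F g sequentially"
      using g by (rule uniform_limit_on_subset) simp
  qed simp
  with out C0_M2_continuous_Icc[of g] have gC: "g \<in> C0_M2"
    by (simp add: C0_M2_def)
  have gd: "diagonal (g 1)"
    unfolding diagonal_def
  proof (intro allI impI)
    fix i j :: 2
    assume "i \<noteq> j"
    then have "(\<lambda>n. F n 1 $ i $ j) = (\<lambda>n. 0)"
      using F(2) by (auto simp: diagonal_def)
    moreover have "(\<lambda>n. F n 1 $ i $ j) \<longlonglongrightarrow> g 1 $ i $ j"
      by (intro tendsto_vec_nth lim)
    ultimately show "g 1 $ i $ j = 0"
      by (simp add: LIMSEQ_const_iff)
  qed
  have G: "qC_fun (Abs_qC g) = g"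
    using gC gd by (simp add: Abs_qC_inverse)
  have "\<exists>N. \<forall>n\<ge>N. norm (X n - Abs_qC g) < e" if "e > 0" for e
  proof -
    have "e / 8 > 0"
      using that by simp
    with g obtain N where N: "dist (F n t) (g t) < e / 8" if "n \<ge> N" for n t
      unfolding uniform_limit_sequentially_iff by blast
    have "norm (X n - Abs_qC g) < e" if "n \<ge> N" for n
    proof -
      have "norm (X n - Abs_qC g) \<le> e / 2"
      proof (rule norm_qC_le)
        fix t
        show "opnorm (qC_fun (X n - Abs_qC g) t) \<le> e / 2"
          using opnorm_le_norm[of "F n t - g t"] N[OF that, of t]
          by (simp add: qC_ops G F_def dist_norm)
      qed
      then show ?thesis
        using \<open>e > 0\<close> by simp
    qed
    then show ?thesis
      by blast
  qed
  then show ?thesis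
    by blast
qed

instance qC :: cstar_algebra
proof
  fix f g :: qC and c d :: complex and r :: real
  show "scaleC c (f + g) = scaleC c f + scaleC c g" "scaleC (c + d) f = scaleC c f + scaleC d f"
    "scaleC c (scaleC d f) = scaleC (c * d) f"
    "scaleC c f * g = scaleC c (f * g)" "f * scaleC c g = scaleC c (f * g)"
    "star (star f) = f" "star (f + g) = star f + star g"
    "star (scaleC c f) = scaleC (cnj c) (star f)" "star (f * g) = star g * star f"
    by (rule qC_eqI; simp add: qC_ops matrix_mult_component mat_scale_def mat_star_def
        star_complex_def algebra_simps)+
  show "r *\<^sub>R f = scaleC (complex_of_real r) f"
    by (rule scaleR_scaleC_qC)
  show "norm (scaleC c f) = cmod c * norm f"
    by (rule norm_scaleC_qC)
  show "norm (star f * f) = (norm f)\<^sup>2"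
    by (rule norm_star_mult_qC)
  show "convergent X" if "Cauchy X" for X :: "nat \<Rightarrow> qC"
    using complete_qC[of X] that by (simp add: Cauchy_def convergent_def LIMSEQ_def dist_norm)
qed

lemma C0_M2_elementary:
  assumes p: "continuous_on {0..1} p" "p 0 = 0"
  shows "(\<lambda>t. if t \<in> {0<..1} then mat_scale (complex_of_real (p t)) m else 0) \<in> C0_M2"
    (is "?f \<in> C0_M2")
proof -
  have "continuous_on {0..1} (\<lambda>t. mat_scale (complex_of_real (p t)) m)"
    unfolding mat_scale_def by (intro continuous_intros p)
  moreover have "mat_scale (complex_of_real (p t)) m = ?f t" if "t \<in> {0..1}" for t
    using that p(2) by (cases "t = 0") (auto simp: mat_scale_def vec_eq_iff)
  ultimately have "continuous_on {0..1} ?f"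
    by (rule continuous_on_eq)
  then show ?thesis
    using C0_M2_continuous_Icc[of ?f] by (simp add: C0_M2_def)
qed

text \<open>The generators $t\otimes e_{11}$, $t\otimes e_{22}$ and $\sqrt{t-t^2}\otimes e_{21}$.\<close>

lift_definition h0 :: qC is
  "\<lambda>t. if t \<in> {0<..1} then mat_scale (complex_of_real t) (mat_unit 1 1) else 0"
  by (rule conjI, rule C0_M2_elementary)
    (auto simp: diagonal_def mat_scale_def mat_unit_def intro!: continuous_intros)

lift_definition k0 :: qC is
  "\<lambda>t. if t \<in> {0<..1} then mat_scale (complex_of_real t) (mat_unit 2 2) else 0"
  by (rule conjI, rule C0_M2_elementary)
    (auto simp: diagonal_def mat_scale_def mat_unit_def intro!: continuous_intros)

lift_definition x0 :: qC is
  "\<lambda>t. if t \<in> {0<..1} then mat_scale (complex_of_real (sqrt (t - t\<^sup>2))) (mat_unit 2 1) else 0"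
  by (rule conjI, rule C0_M2_elementary)
    (auto simp: diagonal_def mat_scale_def mat_unit_def intro!: continuous_intros)

end

theory Submission
  imports Defs "HOL-Complex_Analysis.Cauchy_Integral_Formula"
begin

text \<open>Put \<open>g = h + k\<close> and \<open>w = x + x\<^sup>*\<close>. The relations force \<open>g\<close> to commute with all the
  generators and \<open>w\<^sup>2 = g - g\<^sup>2\<close>, so \<open>u = (2g - 1) + 2iw\<close> is unitary in the unitization and
  \<open>4ug = (1 + u)\<^sup>2\<close>. A polynomial in \<open>g\<close> thus becomes a trigonometric polynomial in \<open>u\<close>;
  Cauchy's estimates for its coefficients, applied to high powers, give
  \<open>\<parallel>p(g)\<parallel> \<le> sup {\<bar>p(t)\<bar> | 0 \<le> t \<le> 1}\<close> without any spectral theory. The elements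
  \<open>p(g) h + q(g) k + r(g) x + s(g) x\<^sup>*\<close> form a \<open>*\<close>-algebra with universal structure
  constants, dense in \<open>q\<complex>\<close> by Weierstrass, and the norm bound lets the obvious map extend
  by continuity. Uniqueness follows since \<open>*\<close>-homomorphisms are contractive: if \<open>a\<close> is
  self-adjoint and \<open>\<parallel>a\<parallel> < 1\<close>, then \<open>a\<^sup>2 + (1 - c)\<^sup>2 = 1\<close> for some self-adjoint \<open>c\<close> commuting
  with \<open>a\<close>, and this relation bounds the norm of the image of \<open>a\<close> by 1.\<close>

section \<open>C*-algebras\<close>

lemma scaleC_minus_right: "scaleC c (- x) = - scaleC c (x::'a::cstar_algebra)"
  using scaleC_add_right[of c "- x" x] by (simp add: scaleC_zero_right_eq eq_neg_iff_add_eq_0)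

lemma scaleC_minus_left: "scaleC (- c) x = - scaleC c (x::'a::cstar_algebra)"
  using scaleC_add_left[of "- c" c x] by (simp add: scaleC_zero_left_eq eq_neg_iff_add_eq_0)

lemma scaleC_minus_one: "scaleC (- 1) x = - (x::'a::cstar_algebra)"
  by (simp add: scaleC_minus_left scaleC_one_eq)

lemma scaleC_diff_right: "scaleC c (x - y) = scaleC c x - scaleC c (y::'a::cstar_algebra)"
  using scaleC_add_right[of c x "- y"] by (simp add: scaleC_minus_right)

lemma star_zero: "star 0 = (0::'a::cstar_algebra)"
  using star_scaleC[of 0 "0::'a"] by (simp add: scaleC_zero_left_eq)

lemma star_minus: "star (- x) = - star (x::'a::cstar_algebra)"
  using star_scaleC[of "- 1" x] by (simp add: scaleC_minus_one)

lemma star_diff: "star (x - y) = star x - star (y::'a::cstar_algebra)"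
  using star_add[of x "- y"] by (simp add: star_minus)

lemma star_scaleR: "star (r *\<^sub>R x) = r *\<^sub>R star (x::'a::cstar_algebra)"
  by (simp add: scaleR_scaleC star_scaleC)

lemma norm_star: "norm (star x) = norm (x::'a::cstar_algebra)"
proof -
  have le: "norm y \<le> norm (star y)" for y :: 'a
  proof (cases "y = 0")
    case False
    have "norm y * norm y \<le> norm (star y) * norm y"
      using norm_star_mult[of y] norm_mult_ineq[of "star y" y] by (simp add: power2_eq_square)
    with False show ?thesis
      by simp
  qed (simp add: star_zero)
  show ?thesis
    using le[of x] le[of "star x"] by (simp add: star_star)
qed

lemma bounded_linear_star: "bounded_linear (star :: 'a::cstar_algebra \<Rightarrow> 'a)"
  by (rule bounded_linear_intro[where K = 1]) (simp_all add: star_add star_scaleR norm_star)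

lemma bounded_linear_scaleC: "bounded_linear (scaleC c :: 'a::cstar_algebra \<Rightarrow> 'a)"
  by (rule bounded_linear_intro[where K = "cmod c"])
    (simp_all add: scaleC_add_right scaleR_scaleC scaleC_scaleC norm_scaleC mult.commute)

lemmas scaleC_simps = scaleC_add_right scaleC_add_left scaleC_diff_right scaleC_minus_right
  scaleC_minus_left scaleC_scaleC scaleC_one_eq scaleC_zero_left_eq scaleC_zero_right_eq
  mult_scaleC_left mult_scaleC_right

lemmas star_simps = star_add star_diff star_minus star_zero star_mult star_star star_scaleC

section \<open>Contractivity of star homomorphisms\<close>

text \<open>The operator in the conclusion is left multiplication by the unitary
  \<open>(c - 1) + \<i> a\<close> of the unitization; letting it act on the algebra avoids
  a norm on the unitization.\<close>

lemma norm_unitary_mult: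
  fixes a c v :: "'a::cstar_algebra"
  assumes "star a = a" "star c = c" "a * c = c * a" and sq: "a * a = c + c - c * c"
  shows "norm (c * v - v + scaleC \<i> (a * v)) = norm v"
proof -
  let ?u = "c * v - v + scaleC \<i> (a * v)"
  have aa: "a * (a * y) = c * y + c * y - c * (c * y)" for y
    using arg_cong[OF sq, of "\<lambda>z. z * y"] by (simp add: algebra_simps)
  have ac: "a * (c * y) = c * (a * y)" for y
    using arg_cong[OF assms(3), of "\<lambda>z. z * y"] by (simp add: mult.assoc)
  have "star ?u * ?u = star v * v"
    by (simp add: star_simps scaleC_simps assms(1,2) algebra_simps aa ac)
  then show ?thesis
    using norm_star_mult[of ?u] norm_star_mult[of v] by simp
qed

text \<open>The unitaries \<open>(c - 1) + i a\<close> and \<open>(c - 1) - i a\<close> differ by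
  \<open>2 i a\<close>. Applied to \<open>a\<close>, both preserve its norm, so the triangle
  inequality and the C*-identity give \<open>2 (norm a)^2 \<le> 2 norm a\<close>.\<close>

lemma norm_le_one_if_square:
  fixes a c :: "'a::cstar_algebra"
  assumes "star a = a" "star c = c" "a * c = c * a" "a * a = c + c - c * c"
  shows "norm a \<le> 1"
proof -
  let ?u = "c * a - a + scaleC \<i> (a * a)" and ?v = "c * a - a + scaleC \<i> (- a * a)"
  have "norm ?u = norm a" "norm ?v = norm a"
    using assms norm_unitary_mult[of a c a] norm_unitary_mult[of "- a" c a]
    by (simp_all add: star_minus)
  moreover have "?u - ?v = scaleC (2 * \<i>) (a * a)"
    by (simp add: scaleC_simps flip: scaleC_add_left)
  moreover have "norm (scaleC (2 * \<i>) (a * a)) = 2 * (norm a)\<^sup>2"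
    using norm_star_mult[of a] assms(1) by (simp add: norm_scaleC norm_mult)
  ultimately have "2 * (norm a)\<^sup>2 \<le> 2 * norm a"
    using norm_triangle_ineq4[of ?u ?v] by simp
  then have "norm a * norm a \<le> 1 * norm a"
    by (simp add: power2_eq_square)
  then show ?thesis
    by (cases "a = 0") simp_all
qed

text \<open>Formally \<open>c = 1 - sqrt (1 - a^2)\<close>, which solves
  \<open>2 c = a^2 + c^2\<close> and so is the fixed point of a map contracting by the factor
  \<open>norm a\<close>. Self-adjointness and commutation with \<open>a\<close> are built into the
  closed set \<open>S\<close>.\<close>

lemma one_minus_square_root:
  fixes a :: "'a::cstar_algebra"
  assumes sa: "star a = a" and norm: "norm a < 1"
  obtains c where "star c = c" "a * c = c * a" "a * a = c + c - c * c"
proof -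
  define S where "S = {c. norm c \<le> norm a \<and> star c = c \<and> a * c = c * a}"
  define f where "f c = (1 / 2) *\<^sub>R (a * a + c * c)" for c
  have "closed S"
    unfolding S_def
    by (intro closed_Collect_conj closed_Collect_le closed_Collect_eq continuous_intros
        bounded_linear.continuous_on[OF bounded_linear_star])
  then have "complete S"
    by (simp add: complete_eq_closed)
  moreover have "S \<noteq> {}"
    by (auto simp: S_def star_zero intro!: exI[of _ 0])
  moreover have "f c \<in> S" if "c \<in> S" for c
  proof -
    have ca: "norm c \<le> norm a" and c: "star c = c" "a * c = c * a"
      using that by (auto simp: S_def)
    have "norm (f c) \<le> (1 / 2) * (norm (a * a) + norm (c * c))"
      using norm_triangle_ineq[of "a * a" "c * c"] by (simp add: f_def)
    also have "\<dots> \<le> (1 / 2) * (norm a * norm a + norm a * norm a)"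
      by (intro mult_left_mono add_mono order_trans[OF norm_mult_ineq] mult_mono ca) simp_all
    also have "\<dots> \<le> norm a"
      using norm mult_left_le[of "norm a" "norm a"] by simp
    finally have "norm (f c) \<le> norm a" .
    moreover have "a * (c * c) = c * c * a"
      using c(2) by (simp flip: mult.assoc) (simp add: mult.assoc)
    ultimately show ?thesis
      using c sa by (simp add: S_def f_def star_scaleR star_simps algebra_simps)
  qed
  moreover have "dist (f c) (f d) \<le> norm a * dist c d" if "c \<in> S" "d \<in> S" for c d
  proof -
    have "norm (c * c - d * d) = norm (c * (c - d) + (c - d) * d)"
      by (simp add: algebra_simps)
    also have "\<dots> \<le> norm c * norm (c - d) + norm (c - d) * norm d"
      by (intro order_trans[OF norm_triangle_ineq] add_mono norm_mult_ineq)
    also have "\<dots> \<le> norm a * norm (c - d) + norm (c - d) * norm a"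
      using that by (intro add_mono mult_mono) (auto simp: S_def)
    finally show ?thesis
      by (simp add: f_def dist_norm flip: scaleR_diff_right)
  qed
  ultimately obtain c where "c \<in> S" "f c = c"
    using Banach_fix[of S "norm a" f] norm by auto
  moreover have "a * a = c + c - c * c"
  proof -
    have "2 *\<^sub>R f c = 2 *\<^sub>R c"
      using \<open>f c = c\<close> by simp
    then show ?thesis
      by (simp add: f_def scaleR_2 eq_diff_eq)
  qed
  ultimately show ?thesis
    using that by (auto simp: S_def)
qed

lemma star_homD:
  assumes "star_hom \<phi>"
  shows "\<phi> (x + y) = \<phi> x + \<phi> y" "\<phi> (scaleC c x) = scaleC c (\<phi> x)" "\<phi> (x * y) = \<phi> x * \<phi> y"
    "\<phi> (star x) = star (\<phi> x)" "\<phi> 0 = 0" "\<phi> (x - y) = \<phi> x - \<phi> y"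
proof -
  have *: "\<phi> (x + y) = \<phi> x + \<phi> y" "\<phi> (scaleC c x) = scaleC c (\<phi> x)" "\<phi> (x * y) = \<phi> x * \<phi> y"
    "\<phi> (star x) = star (\<phi> x)" for x y c
    using assms by (auto simp: star_hom_def)
  then show "\<phi> (x + y) = \<phi> x + \<phi> y" "\<phi> (scaleC c x) = scaleC c (\<phi> x)" "\<phi> (x * y) = \<phi> x * \<phi> y"
    "\<phi> (star x) = star (\<phi> x)"
    by blast+
  show "\<phi> 0 = 0"
    using *(2)[of 0 0] by (simp add: scaleC_zero_left_eq)
  show "\<phi> (x - y) = \<phi> x - \<phi> y"
    using *(1)[of "x - y" y] by simp
qed

text \<open>\<open>star_hom\<close> demands no continuity, but \<open>\<phi>\<close> preserves the
  relation from \<open>one_minus_square_root\<close>, which bounds the image.\<close>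

lemma norm_star_hom_le:
  assumes \<phi>: "star_hom \<phi>"
  shows "norm (\<phi> a) \<le> norm a"
proof -
  have sa: "norm (\<phi> y) \<le> norm y" if "star y = y" for y
  \<comment> \<open>Any \<open>r\<close> strictly above \<open>norm y\<close> scales
    \<open>y\<close> into the open unit ball; \<open>r\<close> may then decrease to
    \<open>norm y\<close>.\<close>
  proof (rule dense_ge)
    fix r
    assume r: "norm y < r"
    then have "0 < r"
      using norm_ge_zero[of y] by linarith
    define z where "z = (1 / r) *\<^sub>R y"
    have "star z = z" "norm z < 1"
      using r \<open>0 < r\<close> that by (simp_all add: z_def star_scaleR)
    then obtain c where c: "star c = c" "z * c = c * z" "z * z = c + c - c * c"
      by (rule one_minus_square_root)
    have "norm (\<phi> z) \<le> 1"
      using \<open>star z = z\<close> c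
      by (intro norm_le_one_if_square[of _ "\<phi> c"]) (simp_all flip: star_homD[OF \<phi>])
    moreover have "\<phi> z = (1 / r) *\<^sub>R \<phi> y"
      by (simp only: z_def scaleR_scaleC star_homD[OF \<phi>])
    ultimately show "norm (\<phi> y) \<le> r"
      using \<open>0 < r\<close> by simp
  qed
  have "(norm (\<phi> a))\<^sup>2 = norm (\<phi> (star a * a))"
    by (simp add: star_homD[OF \<phi>] norm_star_mult)
  also have "\<dots> \<le> (norm a)\<^sup>2"
    using sa[of "star a * a"] by (simp add: star_simps norm_star_mult)
  finally show ?thesis
    by (simp add: power2_le_iff_abs_le)
qed

lemma continuous_on_star_hom: "star_hom \<phi> \<Longrightarrow> continuous_on S \<phi>"
  by (intro linear_continuous_on bounded_linear_intro[where K = 1])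
    (simp_all add: star_homD scaleR_scaleC norm_star_hom_le)

section \<open>Extension from a dense subalgebra\<close>

text \<open>The closure of the graph \<open>R\<close> is again the graph of a \<open>*\<close>-homomorphism.\<close>

lemma star_hom_extension:
  fixes R :: "('a::cstar_algebra \<times> 'b::cstar_algebra) set"
  assumes add: "\<And>x y a b. (x, a) \<in> R \<Longrightarrow> (y, b) \<in> R \<Longrightarrow> (x + y, a + b) \<in> R"
    and scale: "\<And>c x a. (x, a) \<in> R \<Longrightarrow> (scaleC c x, scaleC c a) \<in> R"
    and mult: "\<And>x y a b. (x, a) \<in> R \<Longrightarrow> (y, b) \<in> R \<Longrightarrow> (x * y, a * b) \<in> R"
    and star: "\<And>x a. (x, a) \<in> R \<Longrightarrow> (star x, star a) \<in> R"
    and bound: "\<And>x a. (x, a) \<in> R \<Longrightarrow> norm a \<le> C * norm x"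
    and dense: "closure (fst ` R) = UNIV"
  obtains \<phi> where "star_hom \<phi>" "\<And>x a. (x, a) \<in> R \<Longrightarrow> \<phi> x = a"
proof -
  \<comment> \<open>\<open>Q\<close> is the sequential closure of \<open>R\<close>, kept as a
    relation until it is shown to be total and single-valued.\<close>
  define Q where "Q x a \<longleftrightarrow> (\<exists>X A. (\<forall>n. (X n, A n) \<in> R) \<and> X \<longlonglongrightarrow> x \<and> A \<longlonglongrightarrow> a)" for x a
  have Q_R: "Q x a" if "(x, a) \<in> R" for x a
    unfolding Q_def using that by (intro exI[of _ "\<lambda>_. x"] exI[of _ "\<lambda>_. a"]) simp
  have Q_I: "Q x a" if "\<And>n. (X n, A n) \<in> R" "X \<longlonglongrightarrow> x" "A \<longlonglongrightarrow> a" for X A x a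
    unfolding Q_def using that by blast
  have Q_E: thesis
    if "Q x a" "\<And>X A. (\<And>n. (X n, A n) \<in> R) \<Longrightarrow> X \<longlonglongrightarrow> x \<Longrightarrow> A \<longlonglongrightarrow> a \<Longrightarrow> thesis"
    for x a thesis
    using that unfolding Q_def by blast
  have Q_add: "Q (x + y) (a + b)" if "Q x a" "Q y b" for x y a b
    by (rule Q_E[OF that(1)], rule Q_E[OF that(2)], rule Q_I, (rule add; assumption))
      (intro tendsto_add; assumption)+
  have Q_mult: "Q (x * y) (a * b)" if "Q x a" "Q y b" for x y a b
    by (rule Q_E[OF that(1)], rule Q_E[OF that(2)], rule Q_I, (rule mult; assumption))
      (intro tendsto_mult; assumption)+
  have Q_scale: "Q (scaleC c x) (scaleC c a)" if "Q x a" for c x a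
    by (rule Q_E[OF that], rule Q_I, (rule scale; assumption))
      (rule bounded_linear.tendsto[OF bounded_linear_scaleC]; assumption)+
  have Q_star: "Q (star x) (star a)" if "Q x a" for x a
    by (rule Q_E[OF that], rule Q_I, (rule star; assumption))
      (rule bounded_linear.tendsto[OF bounded_linear_star]; assumption)+
  have Q_bound: "norm a \<le> C * norm x" if "Q x a" for x a
  proof -
    obtain X A where XA: "\<And>n. (X n, A n) \<in> R" "X \<longlonglongrightarrow> x" "A \<longlonglongrightarrow> a"
      using \<open>Q x a\<close> by (auto simp: Q_def)
    have "(\<lambda>n. norm (A n)) \<longlonglongrightarrow> norm a" "(\<lambda>n. C * norm (X n)) \<longlonglongrightarrow> C * norm x"
      using XA by (auto intro!: tendsto_intros)
    then show ?thesis
      using bound[OF XA(1)] by (intro LIMSEQ_le) auto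
  qed
  have diff: "(x - y, a - b) \<in> R" if "(x, a) \<in> R" "(y, b) \<in> R" for x y a b
    using add[OF that(1) scale[OF that(2), of "- 1"]] by (simp add: scaleC_minus_one)
  have "\<exists>a. Q x a" for x
  proof -
    have "x \<in> closure (fst ` R)"
      by (simp add: dense)
    then obtain X where X: "\<And>n. X n \<in> fst ` R" "X \<longlonglongrightarrow> x"
      unfolding closure_sequential by auto
    have "\<forall>n. \<exists>a. (X n, a) \<in> R"
      using X(1) by force
    then obtain A where A: "(X n, A n) \<in> R" for n
      by metis
    have "Cauchy A"
    proof (rule metric_CauchyI)
      fix e :: real
      assume "0 < e"
      \<comment> \<open>\<open>\<bar>C\<bar> + 1\<close> is a positive substitute for
        \<open>C\<close>, whose sign is unknown.\<close>
      then obtain M where M: "dist (X m) (X n) < e / (\<bar>C\<bar> + 1)" if "M \<le> m" "M \<le> n" for m n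
        using metric_CauchyD[OF LIMSEQ_imp_Cauchy[OF X(2)], of "e / (\<bar>C\<bar> + 1)"] by auto
      have "dist (A m) (A n) < e" if "M \<le> m" "M \<le> n" for m n
      proof -
        have "norm (A m - A n) \<le> C * norm (X m - X n)"
          by (intro bound diff A)
        also have "\<dots> \<le> (\<bar>C\<bar> + 1) * norm (X m - X n)"
          by (intro mult_right_mono) auto
        also have "\<dots> < e"
          using M[OF that] by (simp add: dist_norm field_simps)
        finally show ?thesis
          by (simp add: dist_norm)
      qed
      then show "\<exists>M. \<forall>m\<ge>M. \<forall>n\<ge>M. dist (A m) (A n) < e"
        by blast
    qed
    then obtain a where "A \<longlonglongrightarrow> a"
      using Cauchy_convergent convergentD by blast
    then show ?thesis
      unfolding Q_def using A X(2) by blast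
  qed
  then obtain \<phi> where \<phi>: "Q x (\<phi> x)" for x
    by metis
  have unique: "\<phi> x = a" if "Q x a" for x a
  proof -
    \<comment> \<open>Two values at \<open>x\<close> differ by a value at 0, which the bound forces
      to be 0.\<close>
    have "Q (x - x) (\<phi> x - a)"
      using Q_add[OF \<phi>[of x] Q_scale[OF that, of "- 1"]] by (simp add: scaleC_minus_one)
    then show ?thesis
      using Q_bound by fastforce
  qed
  have "star_hom \<phi>"
    unfolding star_hom_def
    by (intro conjI allI unique Q_add Q_mult Q_scale Q_star \<phi>)
  then show thesis
    using that Q_R unique by blast
qed

section \<open>Polynomials in a complex linear operator\<close>

definition linear_op :: "('a::cstar_algebra \<Rightarrow> 'b::cstar_algebra) \<Rightarrow> bool" where
  "linear_op L \<longleftrightarrow> (\<forall>u v. L (u + v) = L u + L v) \<and> (\<forall>c v. L (scaleC c v) = scaleC c (L v))"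

text \<open>Acting on vectors gives the constant term a meaning, as a multiple of the identity
  operator, in an algebra without unit.\<close>

definition poly_act :: "complex poly \<Rightarrow> ('a::cstar_algebra \<Rightarrow> 'a) \<Rightarrow> 'a \<Rightarrow> 'a" where
  "poly_act p L v = (\<Sum>i\<le>degree p. scaleC (coeff p i) ((L ^^ i) v))"

lemma linear_op_add: "linear_op L \<Longrightarrow> L (u + v) = L u + L v"
  and linear_op_scaleC: "linear_op L \<Longrightarrow> L (scaleC c v) = scaleC c (L v)"
  by (simp_all add: linear_op_def)

lemma linear_op_zero: "linear_op L \<Longrightarrow> L 0 = 0"
  using linear_op_scaleC[of L 0 0] by (simp add: scaleC_zero_left_eq)

lemma linear_op_sum: "linear_op L \<Longrightarrow> L (sum f A) = (\<Sum>i\<in>A. L (f i))"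
  by (induction A rule: infinite_finite_induct) (simp_all add: linear_op_zero linear_op_add)

lemma linear_op_mult: "linear_op (\<lambda>v. a * v)" "linear_op (\<lambda>v. v * a)"
  by (simp_all add: linear_op_def algebra_simps scaleC_simps)

lemma linear_op_star_hom: "star_hom \<phi> \<Longrightarrow> linear_op \<phi>"
  by (simp add: linear_op_def star_homD)

lemma poly_act_eq_sum:
  assumes "degree p \<le> n"
  shows "poly_act p L v = (\<Sum>i\<le>n. scaleC (coeff p i) ((L ^^ i) v))"
  unfolding poly_act_def using assms
  by (intro sum.mono_neutral_left) (auto simp: coeff_eq_0 scaleC_zero_left_eq)

lemma poly_act_0 [simp]: "poly_act 0 L v = 0"
  by (simp add: poly_act_def scaleC_zero_left_eq)

lemma poly_act_pCons:
  assumes "linear_op L"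
  shows "poly_act (pCons c p) L v = scaleC c v + L (poly_act p L v)"
proof -
  have "poly_act (pCons c p) L v
    = (\<Sum>i\<le>Suc (degree p). scaleC (coeff (pCons c p) i) ((L ^^ i) v))"
    by (intro poly_act_eq_sum degree_pCons_le)
  also have "\<dots> = scaleC c v + L (poly_act p L v)"
    by (subst sum.atMost_Suc_shift)
      (simp add: poly_act_def linear_op_sum[OF assms] linear_op_scaleC[OF assms])
  finally show ?thesis .
qed

lemma poly_act_monom: "poly_act (monom 1 n) L v = (L ^^ n) v"
proof -
  have "poly_act (monom 1 n) L v = (\<Sum>i\<le>n. if i = n then (L ^^ n) v else 0)"
    unfolding poly_act_eq_sum[OF degree_monom_le]
    by (intro sum.cong) (auto simp: scaleC_one_eq scaleC_zero_left_eq)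
  then show ?thesis
    by simp
qed

lemma poly_act_add: "linear_op L \<Longrightarrow> poly_act (p + q) L v = poly_act p L v + poly_act q L v"
  by (induction p q rule: poly_induct2)
    (simp_all add: poly_act_pCons scaleC_simps linear_op_add algebra_simps)

lemma poly_act_smult: "linear_op L \<Longrightarrow> poly_act (smult c p) L v = scaleC c (poly_act p L v)"
  by (induction p) (simp_all add: poly_act_pCons scaleC_simps linear_op_scaleC)

lemma poly_act_mult: "linear_op L \<Longrightarrow> poly_act (p * q) L v = poly_act p L (poly_act q L v)"
  by (induction p)
    (simp_all add: poly_act_pCons poly_act_add poly_act_smult scaleC_simps)

text \<open>The source of the rules that move \<open>poly_act\<close> past right and left
  multiplications and past star homomorphisms.\<close>

lemma poly_act_intertwine:
  assumes "linear_op M" "linear_op L" "linear_op L'" "\<And>v. M (L v) = L' (M v)"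
  shows "M (poly_act p L v) = poly_act p L' (M v)"
  by (induction p)
    (simp_all add: poly_act_pCons assms linear_op_add[OF assms(1)] linear_op_scaleC[OF assms(1)]
      linear_op_zero[OF assms(1)])

lemma linear_op_poly_act: "linear_op L \<Longrightarrow> linear_op (poly_act p L)"
  unfolding linear_op_def[of "poly_act p L"]
proof (intro conjI allI)
  assume L: "linear_op L"
  show "poly_act p L (u + v) = poly_act p L u + poly_act p L v" for u v
    by (induction p) (simp_all add: poly_act_pCons L linear_op_add[OF L] scaleC_simps algebra_simps)
  show "poly_act p L (scaleC c v) = scaleC c (poly_act p L v)" for c v
    by (induction p)
      (simp_all add: poly_act_pCons L linear_op_scaleC[OF L] scaleC_simps algebra_simps)
qed

lemma poly_act_mult_right: "poly_act p ((*) a) v * b = poly_act p ((*) a) (v * b)"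
  by (rule poly_act_intertwine[OF linear_op_mult(2) linear_op_mult(1) linear_op_mult(1)])
    (simp add: mult.assoc)

lemma poly_act_mult_left:
  assumes "a * b = b * a"
  shows "b * poly_act p ((*) a) v = poly_act p ((*) a) (b * v)"
  by (rule poly_act_intertwine[OF linear_op_mult(1) linear_op_mult(1) linear_op_mult(1)])
    (metis assms mult.assoc)

lemma poly_act_star_hom:
  assumes "star_hom \<phi>"
  shows "\<phi> (poly_act p ((*) a) v) = poly_act p ((*) (\<phi> a)) (\<phi> v)"
  by (rule poly_act_intertwine)
    (simp_all add: assms linear_op_star_hom linear_op_mult star_homD)

lemma map_poly_cnj_pCons: "map_poly cnj (pCons c p) = pCons (cnj c) (map_poly cnj p)"
  by (simp add: map_poly_pCons)

text \<open>Adjoints put the powers of \<open>a\<close> to the right of \<open>star v\<close>, where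
  \<open>poly_act\<close> cannot express them; the factor \<open>u\<close> receives them. In
  \<open>star_poly_act\<close> commutation moves them to the left instead.\<close>

lemma star_poly_act_mult:
  assumes "star a = a"
  shows "star (poly_act p ((*) a) v) * u = star v * poly_act (map_poly cnj p) ((*) a) u"
proof (induction p arbitrary: u)
  case (pCons c p)
  then show ?case
    by (simp add: poly_act_pCons linear_op_mult map_poly_cnj_pCons star_simps scaleC_simps
        mult.assoc
        distrib_left distrib_right assms poly_act_mult_right poly_act_mult_left[OF refl, of a "map_poly cnj p" u])
qed (simp add: star_zero)

lemma star_poly_act:
  assumes "star a = a" "star v * a = a * star v"
  shows "star (poly_act p ((*) a) v) = poly_act (map_poly cnj p) ((*) a) (star v)"
proof (induction p)
  case (pCons c p)
  then show ?case
    by (simp add: poly_act_pCons linear_op_mult map_poly_cnj_pCons star_simps assms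
        poly_act_mult_right
        poly_act_mult_left[OF refl, of a "map_poly cnj p" "star v"])
qed (simp add: star_zero)

text \<open>By the C*-identity, with the adjoint of \<open>p(a)\<close> moved to the right factor.
  Trading \<open>p\<close> for \<open>cnj p * p\<close> at most doubles the degree and squares the
  modulus on the real line, as needed for repeated squaring.\<close>

lemma norm_poly_act_square_le:
  assumes "star a = a"
  shows "(norm (poly_act p ((*) a) v))\<^sup>2 \<le> norm v * norm (poly_act (map_poly cnj p * p) ((*) a) v)"
proof -
  have "(norm (poly_act p ((*) a) v))\<^sup>2 = norm (star v * poly_act (map_poly cnj p * p) ((*) a) v)"
    by (simp add: norm_star_mult[symmetric] star_poly_act_mult[OF assms] poly_act_mult
        linear_op_mult)
  also have "\<dots> \<le> norm v * norm (poly_act (map_poly cnj p * p) ((*) a) v)"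
    using norm_mult_ineq[of "star v"] by (simp add: norm_star)
  finally show ?thesis .
qed

text \<open>Cauchy's estimate on the unit circle: the \<open>n\<close>-th derivative at 0 is
  \<open>n!\<close> times the coefficient.\<close>

lemma norm_coeff_le:
  fixes p :: "complex poly"
  assumes "\<And>z. cmod z = 1 \<Longrightarrow> cmod (poly p z) \<le> M"
  shows "cmod (coeff p n) \<le> M"
proof -
  have "(deriv ^^ n) (poly p) = poly ((pderiv ^^ n) p)"
  proof (induction n)
    case (Suc n)
    then show ?case
      by (simp add: ext DERIV_imp_deriv[OF poly_DERIV])
  qed simp
  moreover have "norm ((deriv ^^ n) (poly p) 0) \<le> fact n * M / 1 ^ n"
    by (rule Cauchy_inequality) (auto intro!: holomorphic_intros continuous_intros assms)
  ultimately show ?thesis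
    by (simp add: poly_0_coeff_0 coeff_higher_pderiv pochhammer_fact[symmetric] norm_mult)
qed

section \<open>From the interval to the unit circle\<close>

text \<open>The substitution \<open>t = (1 + z)\<^sup>2 / (4 z)\<close> maps the unit circle onto \<open>[0, 1]\<close>; multiplying by
  \<open>z\<^sup>d\<close> clears the denominators of a polynomial of degree at most \<open>d\<close>.\<close>

lemma circle_substitution:
  fixes p :: "complex poly" and L U :: "'a::cstar_algebra \<Rightarrow> 'a"
  assumes L: "linear_op L" and U: "linear_op U"
    and UL: "\<And>v. U (L v) = scaleC (1 / 4) (v + (U v + U v) + U (U v))"
    and "degree p \<le> d"
  obtains q where "degree q \<le> 2 * d"
    "\<And>z. z \<noteq> 0 \<Longrightarrow> poly q z = z ^ d * poly p ((1 + z)\<^sup>2 / (4 * z))"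
    "\<And>v. poly_act q U v = (U ^^ d) (poly_act p L v)"
proof -
  \<comment> \<open>With \<open>t = (1 + z)^2 / (4 z)\<close> this is \<open>r(z) = z t\<close>, so
    \<open>r(U)\<close> is \<open>U\<close> after \<open>L\<close>.\<close>
  define r :: "complex poly" where "r = [:1 / 4, 1 / 2, 1 / 4:]"
  have r: "poly_act r U v = U (L v)" for v
    using scaleC_add_left[of "1 / 4" "1 / 4" "U v"]
    by (simp add: r_def UL poly_act_pCons U scaleC_simps linear_op_add[OF U]
        linear_op_scaleC[OF U] linear_op_zero[OF U] algebra_simps)
  have "\<exists>q. degree q \<le> 2 * d \<and> (\<forall>z. z \<noteq> 0 \<longrightarrow> poly q z = z ^ d * poly p ((1 + z)\<^sup>2 / (4 * z))) \<and>
    (\<forall>v. poly_act q U v = (U ^^ d) (poly_act p L v))"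
    using \<open>degree p \<le> d\<close>
  proof (induction d arbitrary: p)
    case 0
    then obtain c where "p = [:c:]"
      using degree_eq_zeroE by blast
    then show ?case
      by (intro exI[of _ "[:c:]"])
        (simp add: poly_act_pCons L U linear_op_zero[OF L] linear_op_zero[OF U])
  next
    case (Suc d)
    obtain c p' where p: "p = pCons c p'"
      by (cases p)
    then have "degree p' \<le> d"
      using Suc.prems by (cases "p' = 0") auto
    then obtain q where q: "degree q \<le> 2 * d"
      "\<And>z. z \<noteq> 0 \<Longrightarrow> poly q z = z ^ d * poly p' ((1 + z)\<^sup>2 / (4 * z))"
      "\<And>v. poly_act q U v = (U ^^ d) (poly_act p' L v)"
      using Suc.IH by blast
    \<comment> \<open>From \<open>p = c + t p'\<close>:
      \<open>z^(d+1) p(t) = c z^(d+1) + (z t) z^d p'(t)\<close>, where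
      \<open>z t = r(z)\<close>.\<close>
    let ?q = "smult c (monom 1 (Suc d)) + r * q"
    have "degree (r * q) \<le> 2 * Suc d"
      using degree_mult_le[of r q] q(1) by (simp add: r_def)
    moreover have "degree (smult c (monom 1 (Suc d))) \<le> 2 * Suc d"
      by (intro order_trans[OF degree_smult_le] order_trans[OF degree_monom_le]) simp
    ultimately have "degree ?q \<le> 2 * Suc d"
      by (rule degree_add_le[rotated])
    moreover have "poly ?q z = z ^ Suc d * poly p ((1 + z)\<^sup>2 / (4 * z))" if "z \<noteq> 0" for z
      using that
      by (simp add: p r_def q(2) poly_monom field_simps power2_eq_square)
    moreover have "poly_act ?q U v = (U ^^ Suc d) (poly_act p L v)" for v
    proof -
      have "poly_act (monom 1 (Suc d)) U = U ^^ Suc d"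
        by (rule ext) (rule poly_act_monom)
      then have lin: "linear_op (U ^^ Suc d)"
        using linear_op_poly_act[OF U] by metis
      \<comment> \<open>Polynomials in \<open>U\<close> commute, so \<open>r(U)\<close> can be
        applied first to \<open>p'(L) v\<close>, where it becomes \<open>U\<close> after
        \<open>L\<close>.\<close>
      have "poly_act (r * q) U v = poly_act (monom 1 d * r) U (poly_act p' L v)"
        using U by (simp add: poly_act_mult q(3) poly_act_monom mult.commute[of _ r])
      also have "\<dots> = (U ^^ Suc d) (L (poly_act p' L v))"
        by (simp add: poly_act_mult U poly_act_monom r funpow_swap1)
      finally show ?thesis
        by (simp add: p poly_act_add poly_act_smult poly_act_pCons U L poly_act_monom
            linear_op_add[OF lin] linear_op_scaleC[OF lin] del: funpow.simps)
    qed
    ultimately show ?case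
      by blast
  qed
  then show thesis
    using that by blast
qed

text \<open>For \<open>y = 1 + a\<close> with \<open>a > 0\<close>, Bernoulli's inequality gives
  growth only linear in \<open>2^n\<close>. Squaring it gives
  \<open>y^(2^(n+1)) \<ge> (2^n a)^2\<close>, which outgrows the assumed linear bound.\<close>

lemma le_one_if_power_two_power_le:
  fixes y :: real
  assumes le: "\<And>n. y ^ (2 ^ n) \<le> C * 2 ^ n"
  shows "y \<le> 1"
proof (rule ccontr)
  assume "\<not> y \<le> 1"
  define a where "a = y - 1"
  have "0 < a"
    using \<open>\<not> y \<le> 1\<close> by (simp add: a_def)
  have "2 ^ n \<le> 2 * C / a\<^sup>2" for n :: nat
  proof -
    have "2 ^ n * a \<le> (1 + a) ^ (2 ^ n)"
      using Bernoulli_inequality[of a "2 ^ n"] \<open>0 < a\<close> by simp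
    then have "(2 ^ n * a)\<^sup>2 \<le> ((1 + a) ^ (2 ^ n))\<^sup>2"
      using \<open>0 < a\<close> by (intro power_mono) auto
    also have "\<dots> = y ^ (2 ^ Suc n)"
      by (simp add: a_def mult.commute flip: power_mult)
    also have "\<dots> \<le> C * 2 ^ Suc n"
      by (rule le)
    finally have "2 ^ n * (2 ^ n * a\<^sup>2) \<le> 2 ^ n * (2 * C)"
      by (simp add: power2_eq_square algebra_simps)
    then have "2 ^ n * a\<^sup>2 \<le> 2 * C"
      by (simp only: mult_le_cancel_left_pos zero_less_power zero_less_numeral)
    then show ?thesis
      using \<open>0 < a\<close> by (simp add: pos_le_divide_eq)
  qed
  moreover obtain n where "2 * C / a\<^sup>2 < 2 ^ n"
    using real_arch_pow[of 2] by auto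
  ultimately show False
    by (meson not_less)
qed

section \<open>Norms of polynomials\<close>

text \<open>\<open>w\<close> is a self-adjoint square root of \<open>g - g^2\<close> commuting with
  \<open>g\<close>, so the unitary with real part \<open>2 g - 1\<close> is given
  algebraically.\<close>

locale circle_pair =
  fixes g w :: "'a::cstar_algebra"
  assumes star_g: "star g = g" and star_w: "star w = w" and gw: "g * w = w * g"
    and ww: "w * w = g - g * g"
begin

text \<open>The substitution turns \<open>p\<close> into a polynomial in the isometry
  \<open>U\<close> with at most \<open>2 * degree p + 1\<close> coefficients, each at most
  \<open>M\<close> by Cauchy's estimate.\<close>

lemma norm_poly_act_le_degree:
  assumes M: "\<And>t. t \<in> {0..1} \<Longrightarrow> cmod (poly p (complex_of_real t)) \<le> M"
  shows "norm (poly_act p ((*) g) v) \<le> real (2 * degree p + 1) * M * norm v"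
proof -
  define U where "U v = (g + g) * v - v + scaleC \<i> ((w + w) * v)" for v
  have U: "linear_op U"
    by (simp add: linear_op_def U_def algebra_simps scaleC_simps)
  have norm_U: "norm ((U ^^ n) v) = norm v" for n v
  proof (induction n)
    case (Suc n)
    have "norm (U v) = norm v" for v
      unfolding U_def
      by (rule norm_unitary_mult) (simp_all add: star_simps star_g star_w algebra_simps gw ww)
    with Suc show ?case
      by simp
  qed simp
  have wv: "w * (g * v) = g * (w * v)" "w * (w * v) = g * v - g * (g * v)" for v
    by (simp_all add: gw ww algebra_simps flip: mult.assoc)
  have "U (g * v) + U (g * v) + (U (g * v) + U (g * v)) = v + (U v + U v) + U (U v)" for v
    by (simp add: U_def algebra_simps scaleC_simps wv)
  moreover have "scaleC (1 / 4) (y + y + (y + y)) = y" for y :: 'a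
    using scaleC_add_left[of "1 / 4" "1 / 4" y] scaleC_add_left[of "1 / 2" "1 / 2" y]
    by (simp add: scaleC_add_right scaleC_one_eq)
  ultimately have UL: "U (g * v) = scaleC (1 / 4) (v + (U v + U v) + U (U v))" for v
    by metis
  obtain q where q: "degree q \<le> 2 * degree p"
    "\<And>z. z \<noteq> 0 \<Longrightarrow> poly q z = z ^ degree p * poly p ((1 + z)\<^sup>2 / (4 * z))"
    "\<And>v. poly_act q U v = (U ^^ degree p) (poly_act p ((*) g) v)"
    using circle_substitution[OF linear_op_mult(1) U UL order_refl] by blast
  have "cmod (poly q z) \<le> M" if z: "cmod z = 1" for z
  proof -
    \<comment> \<open>On the unit circle \<open>1 / z = cnj z\<close>, so the argument of
      \<open>p\<close> is \<open>(1 + Re z) / 2\<close>, a point of [0, 1].\<close>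
    have "z \<noteq> 0" "z * cnj z = 1"
      using z complex_norm_square[of z] by auto
    then have "(1 + z)\<^sup>2 / (4 * z) = (2 + (z + cnj z)) / 4"
      by (simp add: field_simps power2_eq_square)
    also have "\<dots> = complex_of_real ((1 + Re z) / 2)"
      by (simp add: complex_add_cnj)
    finally have "cmod (poly q z) = cmod (poly p (complex_of_real ((1 + Re z) / 2)))"
      by (simp only: q(2)[OF \<open>z \<noteq> 0\<close>] norm_mult norm_power z power_one mult_1)
    also have "\<dots> \<le> M"
      using z abs_Re_le_cmod[of z] by (intro M) (simp add: abs_le_iff)
    finally show ?thesis .
  qed
  then have coeff: "cmod (coeff q i) \<le> M" for i
    by (rule norm_coeff_le)
  have "norm (poly_act p ((*) g) v) = norm (poly_act q U v)"
    by (simp add: q(3) norm_U)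
  also have "\<dots> = norm (\<Sum>i\<le>2 * degree p. scaleC (coeff q i) ((U ^^ i) v))"
    by (simp only: poly_act_eq_sum[OF q(1)])
  also have "\<dots> \<le> (\<Sum>i\<le>2 * degree p. M * norm v)"
    by (intro sum_norm_le) (simp add: norm_scaleC norm_U coeff mult_right_mono)
  finally show ?thesis
    by simp
qed

text \<open>Squaring repeatedly removes the degree from the previous bound.\<close>

lemma norm_poly_act_le:
  assumes M: "\<And>t. t \<in> {0..1} \<Longrightarrow> cmod (poly p (complex_of_real t)) \<le> M"
  shows "norm (poly_act p ((*) g) v) \<le> M * norm v"
proof (cases "v = 0")
  case False
  \<comment> \<open>Each passage to \<open>cnj p * p\<close> squares the norm ratio and
    \<open>M\<close> but at most doubles the degree, so the factor in front grows only like
    \<open>2^n\<close>.\<close>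
  have power: "(norm (poly_act p ((*) g) v) / norm v) ^ (2 ^ n)
      \<le> real (2 * 2 ^ n * degree p + 1) * M ^ (2 ^ n)"
    if "\<And>t. t \<in> {0..1} \<Longrightarrow> cmod (poly p (complex_of_real t)) \<le> M" for p M n
    using that
  proof (induction n arbitrary: p M)
    case 0
    then show ?case
      using norm_poly_act_le_degree[of p M v] False by (simp add: divide_le_eq)
  next
    case (Suc n)
    let ?q = "map_poly cnj p * p"
    have "0 \<le> M"
      using order_trans[OF norm_ge_zero Suc.prems[of 0]] by simp
    have "(norm (poly_act p ((*) g) v) / norm v)\<^sup>2 \<le> norm (poly_act ?q ((*) g) v) / norm v"
      using norm_poly_act_square_le[OF star_g, of p v] False
      by (simp add: field_simps power2_eq_square)
    then have "((norm (poly_act p ((*) g) v) / norm v)\<^sup>2) ^ (2 ^ n)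
        \<le> (norm (poly_act ?q ((*) g) v) / norm v) ^ (2 ^ n)"
      by (intro power_mono) auto
    also have "\<dots> \<le> real (2 * 2 ^ n * degree ?q + 1) * (M\<^sup>2) ^ (2 ^ n)"
    proof (rule Suc.IH)
      fix t :: real
      assume "t \<in> {0..1}"
      then show "cmod (poly ?q (complex_of_real t)) \<le> M\<^sup>2"
        using Suc.prems[of t] \<open>0 \<le> M\<close> by (simp add: norm_mult power2_eq_square mult_mono)
    qed
    also have "\<dots> \<le> real (2 * 2 ^ Suc n * degree p + 1) * (M\<^sup>2) ^ (2 ^ n)"
    proof (intro mult_right_mono)
      have "degree ?q \<le> 2 * degree p"
        using degree_mult_le[of "map_poly cnj p" p] map_poly_degree_leq[of cnj p] by linarith
      then have "2 * 2 ^ n * degree ?q \<le> 2 * 2 ^ n * (2 * degree p)"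
        by (intro mult_left_mono) auto
      then show "real (2 * 2 ^ n * degree ?q + 1) \<le> real (2 * 2 ^ Suc n * degree p + 1)"
        by (intro of_nat_mono) (simp add: algebra_simps)
    qed (simp add: \<open>0 \<le> M\<close>)
    finally show ?case
      by (simp flip: power_mult)
  qed
  show ?thesis
  \<comment> \<open>The ratio below divides by \<open>M\<close>; for \<open>M = 0\<close> the bound
    with the degree already gives 0.\<close>
  proof (cases "M = 0")
    case True
    then show ?thesis
      using norm_poly_act_le_degree[OF M] by simp
  next
    case False
    then have "0 < M"
      using order_trans[OF norm_ge_zero M[of 0]] by simp
    have "norm (poly_act p ((*) g) v) / norm v / M \<le> 1"
    proof (rule le_one_if_power_two_power_le)
      fix n
      have "(norm (poly_act p ((*) g) v) / norm v / M) ^ (2 ^ n)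
          \<le> real (2 * 2 ^ n * degree p + 1)"
        using power[OF M, of n] \<open>0 < M\<close>
        by (subst power_divide) (simp only: pos_divide_le_eq zero_less_power)
      also have "\<dots> \<le> real ((2 * degree p + 1) * 2 ^ n)"
        by (intro of_nat_mono) (simp add: algebra_simps)
      finally show "(norm (poly_act p ((*) g) v) / norm v / M) ^ (2 ^ n)
          \<le> real (2 * degree p + 1) * 2 ^ n"
        by (simp only: of_nat_mult of_nat_power of_nat_numeral)
    qed
    then show ?thesis
      using \<open>0 < M\<close> \<open>v \<noteq> 0\<close> by (simp add: divide_le_eq mult.commute)
  qed
qed (simp add: linear_op_zero[OF linear_op_poly_act] linear_op_mult)


end

section \<open>The relations\<close>

lemma eq_zero_if_star_mult_eq_zero: "star y * y = 0 \<Longrightarrow> y = (0::'a::cstar_algebra)"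
  using norm_star_mult[of y] by simp

text \<open>In \<open>qC\<close> the four summands fill the matrix entries 11, 22, 21 and 12, in
  this order.\<close>

definition combination ::
  "'a::cstar_algebra \<Rightarrow> 'a \<Rightarrow> 'a \<Rightarrow> complex poly \<Rightarrow> complex poly \<Rightarrow> complex poly \<Rightarrow> complex poly \<Rightarrow> 'a"
  where
  "combination h k x p q r s = poly_act p ((*) (h + k)) h + poly_act q ((*) (h + k)) k
     + poly_act r ((*) (h + k)) x + poly_act s ((*) (h + k)) (star x)"

lemma combination_star_hom:
  "star_hom \<phi> \<Longrightarrow> \<phi> (combination h k x p q r s) = combination (\<phi> h) (\<phi> k) (\<phi> x) p q r s"
  by (simp add: combination_def star_homD(1,4) poly_act_star_hom)

lemma poly_act_in_cstar_subalgebra: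
  assumes S: "cstar_subalgebra S" and "a \<in> S" "v \<in> S"
  shows "poly_act p ((*) a) v \<in> S"
proof (induction p)
  case 0
  then show ?case
    using S by (simp add: cstar_subalgebra_def)
next
  case (pCons c p)
  then show ?case
    using assms by (simp add: poly_act_pCons linear_op_mult cstar_subalgebra_def)
qed

lemma combination_in_cstar_subalgebra:
  assumes S: "cstar_subalgebra S" and "h \<in> S" "k \<in> S" "x \<in> S"
  shows "combination h k x p q r s \<in> S"
proof -
  have add: "u + v \<in> S" if "u \<in> S" "v \<in> S" for u v
    using S that by (simp add: cstar_subalgebra_def)
  have "star x \<in> S"
    using assms by (simp add: cstar_subalgebra_def)
  then show ?thesis
    unfolding combination_def using assms by (intro add poly_act_in_cstar_subalgebra)
qed

lemma combination_generators:
  "combination h k x 1 0 0 0 = h" "combination h k x 0 1 0 0 = k" "combination h k x 0 0 1 0 = x"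
  by (simp_all add: combination_def one_pCons poly_act_pCons linear_op_mult scaleC_one_eq)

lemma combination_add:
  "combination h k x p q r s + combination h k x p' q' r' s'
    = combination h k x (p + p') (q + q') (r + r') (s + s')"
  by (simp add: combination_def poly_act_add linear_op_mult)

lemma combination_scaleC:
  "scaleC c (combination h k x p q r s)
    = combination h k x (smult c p) (smult c q) (smult c r) (smult c s)"
  by (simp add: combination_def poly_act_smult linear_op_mult scaleC_add_right)

locale qC_triple =
  fixes h k x :: "'a::cstar_algebra"
  assumes star_h: "star h = h" and star_k: "star k = k" and hk: "h * k = 0"
    and star_x_x: "star x * x = h - h * h" and x_star_x: "x * star x = k - k * k"
    and xh: "x * h = k * x"

text \<open>Entrywise comparison. The upper right entry gives
  \<open>star x * k = h * star x\<close>, the adjoint of \<open>x * h = k * x\<close>.\<close>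

lemma relations_iff_qC_triple: "relations h k x \<longleftrightarrow> qC_triple h k x"
proof -
  have "relations h k x \<longleftrightarrow> h * k = 0 \<and> star h = h \<and> star k = k \<and>
      star x * x = h - h * h \<and> x * star x = k - k * k \<and> x * h = k * x \<and>
      (star x * k = h * star x)"
    unfolding relations_def T_def vec_eq_iff forall_2 mat_star_def
    by (simp add: vector_2 matrix_matrix_mult_def sum_2 embed_def one_unitization_def
        minus_unitization_def times_unitization_def plus_unitization_def star_unitization_def
        star_simps scaleC_simps)
      (auto simp: algebra_simps)
  moreover have "star x * k = h * star x" if "star h = h" "star k = k" "x * h = k * x"
    using arg_cong[OF that(3), of star] that(1,2) by (simp add: star_mult)
  ultimately show ?thesis
    by (auto simp: qC_triple_def)
qed

context qC_triple
begin

text \<open>For \<open>y\<close> equal to \<open>star (h * x)\<close>, \<open>x * k\<close> or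
  \<open>x * x\<close>, the product \<open>star y * y\<close> contains \<open>x * star x\<close> or
  \<open>star x * x\<close>, a polynomial in \<open>k\<close> or \<open>h\<close> that a
  neighbouring factor annihilates. The other equations are adjoints.\<close>

lemma products:
  "k * h = 0" "h * x = 0" "x * k = 0" "x * x = 0"
  "star x * h = 0" "k * star x = 0" "star x * star x = 0" "star x * k = h * star x"
proof -
  show kh: "k * h = 0"
    using arg_cong[OF hk, of star] by (simp add: star_simps star_h star_k)
  have "star (star (h * x)) * star (h * x) = h * (x * star x) * h"
    by (simp add: star_simps star_h mult.assoc)
  also have "\<dots> = 0"
    by (simp add: x_star_x algebra_simps kh)
  finally have "star (h * x) = 0"
    by (rule eq_zero_if_star_mult_eq_zero)
  then have "star (star (h * x)) = 0"
    by (simp only: star_zero)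
  then show hx: "h * x = 0"
    by (simp add: star_star)
  have "star (x * k) * (x * k) = k * (star x * x) * k"
    by (simp add: star_simps star_k mult.assoc)
  also have "\<dots> = 0"
    by (simp add: star_x_x algebra_simps hk)
  finally show xk: "x * k = 0"
    by (rule eq_zero_if_star_mult_eq_zero)
  have "star (x * x) * (x * x) = star x * (star x * x) * x"
    by (simp add: star_simps mult.assoc)
  also have "\<dots> = 0"
    by (simp add: star_x_x algebra_simps hx)
  finally show xx: "x * x = 0"
    by (rule eq_zero_if_star_mult_eq_zero)
  show "star x * h = 0" "k * star x = 0" "star x * star x = 0" "star x * k = h * star x"
    using arg_cong[OF hx, of star] arg_cong[OF xk, of star] arg_cong[OF xx, of star]
      arg_cong[OF xh, of star]
    by (simp_all add: star_simps star_h star_k)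
qed

text \<open>This flip carries the estimates for \<open>h\<close> and \<open>x\<close> over to
  \<open>k\<close> and \<open>star x\<close>.\<close>

lemma symmetric: "qC_triple k h (star x)"
  by standard
    (simp_all add: star_star star_h star_k star_x_x x_star_x products)

lemma commutes:
  "(h + k) * h = h * (h + k)" "(h + k) * k = k * (h + k)" "(h + k) * x = x * (h + k)"
  "(h + k) * star x = star x * (h + k)"
  by (simp_all add: distrib_left distrib_right hk products xh)

text \<open>The circle is \<open>(2 (h + k) - 1)\<^sup>2 + (2 (x + x\<^sup>*))\<^sup>2 = 1\<close>.\<close>

sublocale circle_pair "h + k" "x + star x"
  by standard
    (simp_all add: star_simps star_h star_k distrib_left distrib_right hk products xh star_x_x
      x_star_x)

section \<open>Products, adjoints and norms of combinations\<close>

abbreviation act :: "complex poly \<Rightarrow> 'a \<Rightarrow> 'a" where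
  "act p \<equiv> poly_act p ((*) (h + k))"

lemma act_0: "act p 0 = 0"
  by (simp add: linear_op_zero linear_op_poly_act linear_op_mult)

lemmas act_mult_left = poly_act_mult_left[OF commutes(1)] poly_act_mult_left[OF commutes(2)]
  poly_act_mult_left[OF commutes(3)] poly_act_mult_left[OF commutes(4)]

text \<open>\<open>t\<close> and \<open>t'\<close> stand for \<open>h + k\<close> and
  \<open>1 - (h + k)\<close>; they arise from \<open>h * h = (h + k) * h\<close>,
  \<open>star x * x = h - (h + k) * h\<close> and their analogues. The formula is the same for every
  triple, which makes matching combinations multiplicative.\<close>

lemma combination_mult:
  fixes p q r s p' q' r' s' :: "complex poly"
  defines "t \<equiv> [:0, 1:]" and "t' \<equiv> [:1, - 1:]"
  shows "combination h k x p q r s * combination h k x p' q' r' s' =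
    combination h k x (t * (p * p') + t' * (s * r')) (t * (q * q') + t' * (r * s'))
      (t * (r * p' + q * r')) (t * (p * s' + s * q'))"
proof -
  have t: "act (t * a) v = act a ((h + k) * v)" for a v
    by (simp add: t_def poly_act_mult poly_act_pCons linear_op_mult scaleC_simps
        poly_act_mult_left[OF refl])
  have t': "act (t' * a) v = act a (v - (h + k) * v)" for a v
  proof -
    have "act t' v = v - (h + k) * v"
      by (simp add: t'_def poly_act_pCons linear_op_mult scaleC_simps)
    then show ?thesis
      by (simp only: mult.commute[of t' a] poly_act_mult[OF linear_op_mult(1)])
  qed
  have "(h + k) * h = h * h" "(h + k) * k = k * k" "(h + k) * x = k * x"
    "(h + k) * star x = h * star x"
    by (simp_all add: distrib_right hk products)
  note gen = this
  show ?thesis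
    by (simp add: combination_def poly_act_add linear_op_mult t t' gen poly_act_mult
        distrib_left distrib_right poly_act_mult_right act_mult_left hk products act_0
        xh star_x_x x_star_x del: mult_pCons_left mult_pCons_right)
qed

lemma combination_star:
  "star (combination h k x p q r s) = combination h k x (map_poly cnj p) (map_poly cnj q)
    (map_poly cnj s) (map_poly cnj r)"
  by (simp add: combination_def star_add star_poly_act star_g star_h star_k star_star commutes)

text \<open>The weight \<open>t\<close> comes from \<open>h\<close>: as \<open>k\<close> annihilates
  \<open>star c\<close>, the \<open>h\<close> inside \<open>c\<close> acts on \<open>star c\<close>
  like \<open>h + k\<close>, and \<open>c * star c\<close> becomes \<open>t p(t)\<close> at
  \<open>h + k\<close> applied to \<open>star c\<close>. One factor \<open>norm c\<close> then
  cancels.\<close>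

lemma norm_act_h_le:
  assumes M: "\<And>t. t \<in> {0..1} \<Longrightarrow> t * cmod (poly p (complex_of_real t)) \<le> M"
  shows "norm (act p h) \<le> M"
proof -
  define c where "c = act p h"
  have star_c: "star c = act (map_poly cnj p) h"
    by (simp add: c_def star_poly_act star_g star_h commutes)
  have "k * star c = 0"
    by (simp add: star_c act_mult_left products act_0)
  then have "c * star c = act p ((h + k) * star c)"
    by (simp add: c_def poly_act_mult_right distrib_right)
  also have "\<dots> = act (p * [:0, 1:]) (star c)"
    by (simp add: poly_act_mult poly_act_pCons linear_op_mult scaleC_simps del: mult_pCons_right)
  finally have "norm (c * star c) \<le> M * norm (star c)"
    using M norm_poly_act_le[of "p * [:0, 1:]" M "star c"] by (simp add: norm_mult)
  moreover have "norm (c * star c) = norm c * norm c"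
    using norm_star_mult[of "star c"] by (simp add: star_star norm_star power2_eq_square)
  ultimately show ?thesis
    using M[of 0] by (cases "c = 0") (auto simp: norm_star c_def)
qed

text \<open>Reduced to \<open>norm_act_h_le\<close> by the C*-identity: \<open>star x * x\<close>
  contributes \<open>1 - t\<close>, and \<open>t (1 - t)\<close> is the square of the
  weight.\<close>

lemma norm_act_x_le:
  assumes M: "\<And>t. t \<in> {0..1} \<Longrightarrow> sqrt (t - t\<^sup>2) * cmod (poly r (complex_of_real t)) \<le> M"
  shows "norm (act r x) \<le> M"
proof -
  have "0 \<le> M"
    using M[of 0] by simp
  have "star (act r x) * act r x = act (map_poly cnj r * r) (star x * x)"
    by (simp add: star_poly_act_mult star_g act_mult_left poly_act_mult linear_op_mult)
  also have "\<dots> = act (map_poly cnj r * r * [:1, - 1:]) h"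
    by (simp add: poly_act_mult[of _ _ "[:1, - 1:]"] poly_act_pCons linear_op_mult scaleC_simps
        star_x_x distrib_right products del: mult_pCons_right)
  also have "norm \<dots> \<le> M\<^sup>2"
  proof (rule norm_act_h_le)
    fix t :: real
    assume t: "t \<in> {0..1}"
    then have "0 \<le> t - t\<^sup>2"
      by (simp add: power2_eq_square mult_left_le)
    have "cmod (1 - complex_of_real t) = 1 - t"
      using t by (metis abs_of_nonneg atLeastAtMost_iff diff_ge_0_iff_ge norm_of_real of_real_1 of_real_diff)
    then have eq: "cmod (poly (map_poly cnj r * r * [:1, - 1:]) (complex_of_real t))
        = cmod (poly r (complex_of_real t)) * cmod (poly r (complex_of_real t)) * (1 - t)"
      by (simp only: poly_mult norm_mult poly_map_poly_cnj complex_cnj_complex_of_real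
          complex_mod_cnj) simp
    have "t * cmod (poly (map_poly cnj r * r * [:1, - 1:]) (complex_of_real t))
        = (sqrt (t - t\<^sup>2) * cmod (poly r (complex_of_real t)))\<^sup>2"
      using \<open>0 \<le> t - t\<^sup>2\<close>
      by (simp only: eq power_mult_distrib real_sqrt_pow2) (simp add: power2_eq_square algebra_simps)
    also have "\<dots> \<le> M\<^sup>2"
      using M[OF t] \<open>0 \<le> t - t\<^sup>2\<close> by (intro power_mono) auto
    finally show "t * cmod (poly (map_poly cnj r * r * [:1, - 1:]) (complex_of_real t)) \<le> M\<^sup>2" .
  qed
  finally show ?thesis
    using \<open>0 \<le> M\<close> by (simp add: norm_star_mult power2_le_iff_abs_le)
qed

lemma norm_combination_le:
  assumes p: "\<And>t. t \<in> {0..1} \<Longrightarrow> t * cmod (poly p (complex_of_real t)) \<le> M"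
    and q: "\<And>t. t \<in> {0..1} \<Longrightarrow> t * cmod (poly q (complex_of_real t)) \<le> M"
    and r: "\<And>t. t \<in> {0..1} \<Longrightarrow> sqrt (t - t\<^sup>2) * cmod (poly r (complex_of_real t)) \<le> M"
    and s: "\<And>t. t \<in> {0..1} \<Longrightarrow> sqrt (t - t\<^sup>2) * cmod (poly s (complex_of_real t)) \<le> M"
  shows "norm (combination h k x p q r s) \<le> 4 * M"
proof -
  have "norm (act p h) \<le> M" "norm (act r x) \<le> M"
    using norm_act_h_le p norm_act_x_le r by blast+
  moreover have "norm (act q k) \<le> M" "norm (act s (star x)) \<le> M"
    using qC_triple.norm_act_h_le[OF symmetric] q qC_triple.norm_act_x_le[OF symmetric] s
    unfolding add.commute[of k h] by blast+
  ultimately show ?thesis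
    unfolding combination_def
    by (smt (verit) norm_triangle_ineq)
qed

end

section \<open>Density of the polynomial combinations\<close>

lemma real_polynomial_function_imp_poly:
  assumes "real_polynomial_function f"
  obtains p :: "complex poly" where "\<And>t. poly p (complex_of_real t) = complex_of_real (f t)"
proof -
  obtain a n where f: "f = (\<lambda>t. \<Sum>i\<le>n. a i * t ^ i)"
    using assms real_polynomial_function_iff_sum by auto
  show thesis
    by (rule that[of "\<Sum>i\<le>n. monom (complex_of_real (a i)) i"])
      (simp add: f poly_sum poly_monom)
qed

lemma complex_Weierstrass:
  fixes f :: "real \<Rightarrow> complex"
  assumes "compact S" "continuous_on S f" "0 < e"
  obtains p where "\<And>t. t \<in> S \<Longrightarrow> cmod (f t - poly p (complex_of_real t)) < e"
proof -
  obtain g where g: "polynomial_function g" "\<And>t. t \<in> S \<Longrightarrow> cmod (f t - g t) < e"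
    using Stone_Weierstrass_polynomial_function[OF assms] by blast
  have "real_polynomial_function (Re \<circ> g)" "real_polynomial_function (Im \<circ> g)"
    using g(1) bounded_linear_Re bounded_linear_Im by (auto simp: polynomial_function_def)
  then obtain p q where
    "\<And>t. poly p (complex_of_real t) = complex_of_real (Re (g t))"
    "\<And>t. poly q (complex_of_real t) = complex_of_real (Im (g t))"
    by (metis real_polynomial_function_imp_poly comp_apply)
  then have "poly (p + smult \<i> q) (complex_of_real t) = g t" for t
    by (simp add: complex_eq_iff)
  with g(2) show thesis
    by (metis that)
qed

text \<open>The quotient of \<open>f\<close> by the weight need not be bounded, so \<open>f / (\<omega> + \<delta>)\<close> is approximated
  instead, for a small \<open>\<delta>\<close>.\<close>

lemma weighted_Weierstrass:
  fixes f :: "real \<Rightarrow> complex" and \<omega> :: "real \<Rightarrow> real"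
  assumes S: "compact S" and f: "continuous_on S f" and \<omega>: "continuous_on S \<omega>"
    and nonneg: "\<And>t. t \<in> S \<Longrightarrow> 0 \<le> \<omega> t" and zero: "\<And>t. t \<in> S \<Longrightarrow> \<omega> t = 0 \<Longrightarrow> f t = 0"
    and "0 < e"
  obtains p where "\<And>t. t \<in> S \<Longrightarrow> cmod (f t - complex_of_real (\<omega> t) * poly p (complex_of_real t)) < e"
proof -
  obtain B where B: "0 < B" "\<And>t. t \<in> S \<Longrightarrow> cmod (f t) \<le> B"
    using compact_imp_bounded[OF compact_continuous_image[OF f S]] by (auto simp: bounded_pos)
  obtain W where W: "0 < W" "\<And>t. t \<in> S \<Longrightarrow> \<omega> t \<le> W"
    using compact_imp_bounded[OF compact_continuous_image[OF \<omega> S]] by (fastforce simp: bounded_pos)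
  \<comment> \<open>Off \<open>K\<close> the function is already below \<open>e / 2\<close>. On
    \<open>K\<close> the weight is bounded below by compactness, since \<open>f\<close> vanishes
    wherever \<open>\<omega>\<close> does.\<close>
  define K where "K = {t \<in> S. e / 2 \<le> cmod (f t)}"
  have "compact K"
  proof -
    have "K = S \<inter> (\<lambda>t. cmod (f t)) -` {e / 2..}"
      by (auto simp: K_def)
    then have "closed K"
      using continuous_closed_preimage[of S "\<lambda>t. cmod (f t)" "{e / 2..}"] S f
      by (simp add: compact_imp_closed continuous_on_norm)
    moreover have "S \<inter> K = K"
      by (auto simp: K_def)
    ultimately show ?thesis
      using S compact_Int_closed by metis
  qed
  obtain \<eta> where \<eta>: "0 < \<eta>" "\<And>t. t \<in> K \<Longrightarrow> \<eta> \<le> \<omega> t"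
  proof (cases "K = {}")
    case False
    obtain t where t: "t \<in> K" "\<And>u. u \<in> K \<Longrightarrow> \<omega> t \<le> \<omega> u"
      using continuous_attains_inf[OF \<open>compact K\<close> False, of \<omega>] \<omega>
      by (metis (no_types, lifting) K_def continuous_on_subset mem_Collect_eq subsetI)
    then have "\<omega> t \<noteq> 0" "0 \<le> \<omega> t"
      using zero[of t] nonneg[of t] \<open>0 < e\<close> by (auto simp: K_def)
    then show thesis
      using that[of "\<omega> t"] t by simp
  qed (use that[of 1] in simp)
  \<comment> \<open>Chosen so that \<open>\<delta> / \<eta> * B = e / 4\<close>.\<close>
  define \<delta> where "\<delta> = e * \<eta> / (4 * B)"
  have "0 < \<delta>"
    using \<open>0 < e\<close> B(1) \<eta>(1) by (simp add: \<delta>_def)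
  have pos: "0 < \<omega> t + \<delta>" if "t \<in> S" for t
    using nonneg[OF that] \<open>0 < \<delta>\<close> by simp
  define g where "g t = f t / complex_of_real (\<omega> t + \<delta>)" for t
  have "continuous_on S g"
    unfolding g_def using pos by (intro continuous_intros f \<omega>) (force simp flip: of_real_add)
  \<comment> \<open>Multiplying by \<open>\<omega> \<le> W\<close> turns this tolerance into
    \<open>e / 2\<close>.\<close>
  then obtain p where p: "\<And>t. t \<in> S \<Longrightarrow> cmod (g t - poly p (complex_of_real t)) < e / (2 * W)"
    using complex_Weierstrass[OF S, of g "e / (2 * W)"] \<open>0 < e\<close> W(1) by auto
  show thesis
  proof (rule that[of p])
    fix t
    assume t: "t \<in> S"
    have "complex_of_real (\<omega> t) + complex_of_real \<delta> \<noteq> 0"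
      using pos[OF t] by (simp flip: of_real_add)
    then have "f t - complex_of_real (\<omega> t) * g t = complex_of_real (\<delta> / (\<omega> t + \<delta>)) * f t"
      by (simp add: g_def field_simps)
    then have "cmod (f t - complex_of_real (\<omega> t) * g t) = \<delta> / (\<omega> t + \<delta>) * cmod (f t)"
      using pos[OF t] \<open>0 < \<delta>\<close> by (simp add: norm_mult norm_divide flip: of_real_add of_real_divide)
    also have "\<dots> < e / 2"
    proof (cases "t \<in> K")
      case True
      have "\<delta> / (\<omega> t + \<delta>) * cmod (f t) \<le> \<delta> / \<eta> * B"
        using True \<eta> B t \<open>0 < \<delta>\<close> pos[OF t]
        by (intro mult_mono divide_left_mono mult_pos_pos) (auto simp: add_increasing2)
      also have "\<dots> < e / 2"
        using \<eta>(1) B(1) \<open>0 < e\<close> by (simp add: \<delta>_def)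
      finally show ?thesis .
    next
      case False
      have "\<delta> / (\<omega> t + \<delta>) * cmod (f t) \<le> 1 * cmod (f t)"
        using pos[OF t] nonneg[OF t] by (intro mult_right_mono) auto
      also have "\<dots> < e / 2"
        using False t by (simp add: K_def)
      finally show ?thesis .
    qed
    finally have "cmod (f t - complex_of_real (\<omega> t) * g t) < e / 2" .
    moreover have "cmod (complex_of_real (\<omega> t) * g t - complex_of_real (\<omega> t) * poly p (complex_of_real t)) \<le> e / 2"
    proof -
      have "\<omega> t * cmod (g t - poly p (complex_of_real t)) \<le> W * (e / (2 * W))"
        using p[OF t] W t nonneg[OF t] by (intro mult_mono) auto
      then show ?thesis
        using W(1) nonneg[OF t] by (simp add: norm_mult flip: right_diff_distrib)
    qed
    ultimately show "cmod (f t - complex_of_real (\<omega> t) * poly p (complex_of_real t)) < e"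
      using norm_triangle_ineq[of "f t - complex_of_real (\<omega> t) * g t"
          "complex_of_real (\<omega> t) * g t - complex_of_real (\<omega> t) * poly p (complex_of_real t)"] by simp
  qed
qed

section \<open>Matrix entries in \<open>qC\<close>\<close>

lemma qC_generators_nth:
  assumes "t \<in> {0<..1}"
  shows "qC_fun h0 t $ i $ j = (if i = 1 \<and> j = 1 then complex_of_real t else 0)"
    "qC_fun k0 t $ i $ j = (if i = 2 \<and> j = 2 then complex_of_real t else 0)"
    "qC_fun x0 t $ i $ j = (if i = 2 \<and> j = 1 then complex_of_real (sqrt (t - t\<^sup>2)) else 0)"
    "qC_fun (star x0) t $ i $ j = (if i = 1 \<and> j = 2 then complex_of_real (sqrt (t - t\<^sup>2)) else 0)"
  using assms
  by (auto simp: h0.rep_eq k0.rep_eq x0.rep_eq star_qC.rep_eq mat_star_def star_complex_def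
      mat_scale_def mat_unit_def)

lemma qC_triple_generators: "qC_triple h0 k0 x0"
proof -
  have sq: "complex_of_real (sqrt (t - t\<^sup>2)) * complex_of_real (sqrt (t - t\<^sup>2))
      = complex_of_real t - complex_of_real t * complex_of_real t" if "t \<in> {0<..1}" for t
    using that mult_left_le[of t t]
    by (simp add: power2_eq_square flip: of_real_mult of_real_diff)
  have eqI: "f = g" if "\<And>t i j. t \<in> {0<..1} \<Longrightarrow> qC_fun f t $ i $ j = qC_fun g t $ i $ j" for f g
  proof (rule qC_eqI)
    show "qC_fun f t $ i $ j = qC_fun g t $ i $ j" for t i j
      using that[of t i j] by (cases "t \<in> {0<..1}") (simp_all add: qC_outside)
  qed
  show ?thesis
    by (unfold_locales; rule eqI)
      (auto simp: times_qC.rep_eq minus_qC.rep_eq zero_qC.rep_eq matrix_mult_component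
        qC_generators_nth sq star_qC.rep_eq[of h0] star_qC.rep_eq[of k0] mat_star_def star_complex_def)
qed

text \<open>\<open>h0 + k0\<close> is \<open>t\<close> times the identity matrix.\<close>

lemma qC_fun_poly_act:
  assumes t: "t \<in> {0<..1}"
  shows "qC_fun (poly_act p ((*) (h0 + k0)) f) t $ i $ j = poly p (complex_of_real t) * qC_fun f t $ i $ j"
proof (induction p)
  case (pCons c p)
  have "qC_fun ((h0 + k0) * g) t $ i $ j = complex_of_real t * qC_fun g t $ i $ j" for g
    using exhaust_2[of i]
    by (auto simp: times_qC.rep_eq plus_qC.rep_eq matrix_mult_component qC_generators_nth[OF t])
  with pCons show ?case
    by (simp add: poly_act_pCons linear_op_mult plus_qC.rep_eq scaleC_qC.rep_eq mat_scale_def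
        distrib_right[where 'a = complex] mult.assoc)
qed (simp add: zero_qC.rep_eq)

lemma qC_fun_combination:
  assumes t: "t \<in> {0<..1}"
  defines "z \<equiv> complex_of_real t" and "w \<equiv> complex_of_real (sqrt (t - t\<^sup>2))"
  shows "qC_fun (combination h0 k0 x0 p q r s) t $ 1 $ 1 = z * poly p z"
    "qC_fun (combination h0 k0 x0 p q r s) t $ 2 $ 2 = z * poly q z"
    "qC_fun (combination h0 k0 x0 p q r s) t $ 2 $ 1 = w * poly r z"
    "qC_fun (combination h0 k0 x0 p q r s) t $ 1 $ 2 = w * poly s z"
  by (simp_all add: combination_def plus_qC.rep_eq qC_fun_poly_act[OF t] qC_generators_nth[OF t]
      z_def w_def)

lemma norm_qC_nth_le: "cmod (qC_fun f t $ i $ j) \<le> 4 * norm f"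
proof -
  have "cmod (qC_fun f t $ i $ j) \<le> norm (qC_fun f t)"
    by (meson Finite_Cartesian_Product.norm_nth_le order_trans)
  also have "\<dots> \<le> 4 * norm f"
    using norm_le_opnorm[of "qC_fun f t"] opnorm_le_norm_qC[of f t] by linarith
  finally show ?thesis .
qed

lemma norm_qC_le_nth:
  assumes le: "\<And>t i j. t \<in> {0<..1} \<Longrightarrow> cmod (qC_fun f t $ i $ j) \<le> e"
  shows "norm f \<le> 16 * e"
proof (rule norm_qC_le)
  fix t
  have "0 \<le> e"
    using order_trans[OF norm_ge_zero le[of 1 1 1]] by simp
  then have le': "cmod (qC_fun f t $ i $ j) \<le> e" for i j
    using le[of t i j] by (cases "t \<in> {0<..1}") (simp_all add: qC_outside)
  have row: "norm (qC_fun f t $ i) \<le> 2 * e" for i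
    using L2_set_le_sum[of UNIV "\<lambda>j. norm (qC_fun f t $ i $ j)"] le'[of i 1] le'[of i 2]
    by (simp add: norm_vec_def sum_2)
  have "norm (qC_fun f t) \<le> 4 * e"
    using L2_set_le_sum[of UNIV "\<lambda>i. norm (qC_fun f t $ i)"] row[of 1] row[of 2]
    by (simp add: norm_vec_def[of "qC_fun f t"] sum_2)
  then show "opnorm (qC_fun f t) \<le> 16 * e"
    using opnorm_le_norm[of "qC_fun f t"] by linarith
qed

text \<open>Each entry is approximated separately, with weight \<open>t\<close> on the diagonal and
  \<open>sqrt (t - t^2)\<close> off it. The latter weight also vanishes at 1, where the off-diagonal
  entries are 0 by the definition of \<open>qC\<close>.\<close>

lemma closure_combinations:
  "closure {f. \<exists>p q r s. f = combination h0 k0 x0 p q r s} = UNIV"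
proof -
  have "\<exists>p q r s. dist (combination h0 k0 x0 p q r s) f < e" if "0 < e" for f e
  proof -
    have f: "qC_fun f \<in> C0_M2" "diagonal (qC_fun f 1)"
      using qC_fun[of f] by auto
    have f0: "qC_fun f 0 = 0"
      by (rule qC_outside) simp
    then have "continuous_on {0..1} (qC_fun f)"
      using f(1) C0_M2_continuous_Icc[of "qC_fun f"] by (simp add: C0_M2_def)
    then have cont: "continuous_on {0..1} (\<lambda>t. qC_fun f t $ i $ j)" for i j
      by (intro continuous_intros)
    have sqrt0: "t = 0 \<or> t = 1" if "sqrt (t - t\<^sup>2) = 0" for t :: real
      using that by (auto simp: power2_eq_square)
    have le: "t\<^sup>2 \<le> t" if "t \<in> {0..1}" for t :: real
      using that by (simp add: power2_eq_square mult_left_le)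
    \<comment> \<open>\<open>norm_qC_le_nth\<close> costs a factor 16, which leaves
      \<open>e / 2\<close>.\<close>
    have e: "0 < e / 32"
      using \<open>0 < e\<close> by simp
    have diag: "\<exists>p. \<forall>t\<in>{0..1}. cmod (qC_fun f t $ i $ i
        - complex_of_real t * poly p (complex_of_real t)) < e / 32" for i
      using weighted_Weierstrass[OF compact_Icc cont continuous_on_id _ _ e, of i i] f0
      by (metis atLeastAtMost_iff zero_index)
    have offdiag: "\<exists>p. \<forall>t\<in>{0..1}. cmod (qC_fun f t $ i $ j
        - complex_of_real (sqrt (t - t\<^sup>2)) * poly p (complex_of_real t)) < e / 32" if "i \<noteq> j" for i j
    proof -
      have "continuous_on {0..1} (\<lambda>t::real. sqrt (t - t\<^sup>2))"
        by (intro continuous_intros)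
      moreover have "qC_fun f t $ i $ j = 0" if "sqrt (t - t\<^sup>2) = 0" for t
        using sqrt0[OF that] f0 f(2) \<open>i \<noteq> j\<close> by (auto simp: diagonal_def)
      ultimately obtain p where "\<And>t. t \<in> {0..1} \<Longrightarrow> cmod (qC_fun f t $ i $ j
        - complex_of_real (sqrt (t - t\<^sup>2)) * poly p (complex_of_real t)) < e / 32"
        using weighted_Weierstrass[OF compact_Icc cont, of "\<lambda>t. sqrt (t - t\<^sup>2)" i j "e / 32"] e le
        by auto
      then show ?thesis
        by blast
    qed
    have two_neq_one: "(2::2) \<noteq> 1"
      by simp
    obtain p where p: "\<And>t. t \<in> {0..1} \<Longrightarrow>
        cmod (qC_fun f t $ 1 $ 1 - complex_of_real t * poly p (complex_of_real t)) < e / 32"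
      using diag[of 1] by blast
    obtain q where q: "\<And>t. t \<in> {0..1} \<Longrightarrow>
        cmod (qC_fun f t $ 2 $ 2 - complex_of_real t * poly q (complex_of_real t)) < e / 32"
      using diag[of 2] by blast
    obtain r where r: "\<And>t. t \<in> {0..1} \<Longrightarrow> cmod (qC_fun f t $ 2 $ 1
        - complex_of_real (sqrt (t - t\<^sup>2)) * poly r (complex_of_real t)) < e / 32"
      using offdiag[OF two_neq_one] by blast
    obtain s where s: "\<And>t. t \<in> {0..1} \<Longrightarrow> cmod (qC_fun f t $ 1 $ 2
        - complex_of_real (sqrt (t - t\<^sup>2)) * poly s (complex_of_real t)) < e / 32"
      using offdiag[OF two_neq_one[symmetric]] by blast
    have "norm (f - combination h0 k0 x0 p q r s) \<le> 16 * (e / 32)"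
    proof (rule norm_qC_le_nth)
      fix t :: real and i j :: 2
      assume t: "t \<in> {0<..1}"
      show "cmod (qC_fun (f - combination h0 k0 x0 p q r s) t $ i $ j) \<le> e / 32"
        using p[of t] q[of t] r[of t] s[of t] t exhaust_2[of i] exhaust_2[of j]
        by (auto simp: minus_qC.rep_eq qC_fun_combination[OF t])
    qed
    then have "dist (combination h0 k0 x0 p q r s) f < e"
      using \<open>0 < e\<close> by (simp add: dist_norm norm_minus_commute)
    then show ?thesis
      by blast
  qed
  then show ?thesis
    by (fastforce simp: closure_approachable)
qed

text \<open>This makes the map on combinations well defined and bounded. The 16 is 4 for the
  summands times 4 for bounding an entry by the norm.\<close>

lemma norm_combination_le_qC:
  assumes "qC_triple h k x"
  shows "norm (combination h k x p q r s) \<le> 16 * norm (combination h0 k0 x0 p q r s)"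
proof -
  let ?f = "combination h0 k0 x0 p q r s"
  \<comment> \<open>\<open>y\<close> is the weight of the entry. The point 0 is outside the domain
    of the functions in \<open>qC\<close>, but the weight vanishes there.\<close>
  have *: "y t * cmod (poly u (complex_of_real t)) \<le> 4 * norm ?f"
    if "\<And>t. t \<in> {0<..1} \<Longrightarrow> complex_of_real (y t) * poly u (complex_of_real t) = qC_fun ?f t $ i $ j"
      "y 0 = 0" "t \<in> {0..1}" "0 \<le> y t" for y u i j t
  proof (cases "t = 0")
    case False
    with that have "qC_fun ?f t $ i $ j = complex_of_real (y t) * poly u (complex_of_real t)"
      by simp
    then show ?thesis
      using norm_qC_nth_le[of ?f t i j] \<open>0 \<le> y t\<close> by (simp add: norm_mult)
  qed (use that in simp)
  have "norm (combination h k x p q r s) \<le> 4 * (4 * norm ?f)"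
  proof (rule qC_triple.norm_combination_le[OF assms])
    fix t :: real
    assume t: "t \<in> {0..1}"
    then have "0 \<le> sqrt (t - t\<^sup>2)"
      by (simp add: power2_eq_square mult_left_le)
    with t show "t * cmod (poly p (complex_of_real t)) \<le> 4 * norm ?f"
      "t * cmod (poly q (complex_of_real t)) \<le> 4 * norm ?f"
      "sqrt (t - t\<^sup>2) * cmod (poly r (complex_of_real t)) \<le> 4 * norm ?f"
      "sqrt (t - t\<^sup>2) * cmod (poly s (complex_of_real t)) \<le> 4 * norm ?f"
      using *[of "\<lambda>t. t" p 1 1 t] *[of "\<lambda>t. t" q 2 2 t]
        *[of "\<lambda>t. sqrt (t - t\<^sup>2)" r 2 1 t] *[of "\<lambda>t. sqrt (t - t\<^sup>2)" s 1 2 t]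
      by (simp_all add: qC_fun_combination)
  qed
  then show ?thesis
    by simp
qed

section \<open>The universal property\<close>

lemma star_hom_combinations:
  fixes h k x :: "'a::cstar_algebra"
  assumes "qC_triple h k x"
  obtains \<phi> :: "qC \<Rightarrow> 'a" where "star_hom \<phi>" "\<phi> h0 = h" "\<phi> k0 = k" "\<phi> x0 = x"
proof -
  interpret q: qC_triple h0 k0 x0
    by (rule qC_triple_generators)
  interpret a: qC_triple h k x
    by (rule assms)
  \<comment> \<open>The intended map as a relation; that equal combinations have equal images
    follows from \<open>bound\<close>.\<close>
  define R where "R = {(combination h0 k0 x0 p q r s, combination h k x p q r s) | p q r s. True}"
  have R_I: "(f, a) \<in> R" if "f = combination h0 k0 x0 p q r s" "a = combination h k x p q r s"
    for f a p q r s
    using that by (auto simp: R_def)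
  have R_E: thesis
    if "(f, a) \<in> R" "\<And>p q r s. f = combination h0 k0 x0 p q r s \<Longrightarrow> a = combination h k x p q r s \<Longrightarrow> thesis"
    for f a thesis
    using that by (auto simp: R_def)
  have "fst ` R = {f. \<exists>p q r s. f = combination h0 k0 x0 p q r s}"
    by (force simp: R_def)
  then have dense: "closure (fst ` R) = UNIV"
    by (simp add: closure_combinations)
  have bound: "norm a \<le> 16 * norm f" if "(f, a) \<in> R" for f a
    using that by (auto elim!: R_E simp: norm_combination_le_qC[OF assms])
  have scale: "(scaleC c f, scaleC c a) \<in> R" if "(f, a) \<in> R" for c f a
    by (rule R_E[OF that], rule R_I) (simp_all only: combination_scaleC)
  have star: "(star f, star a) \<in> R" if "(f, a) \<in> R" for f a
    by (rule R_E[OF that], rule R_I) (simp_all only: q.combination_star a.combination_star)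
  have add: "(f + g, a + b) \<in> R" if "(f, a) \<in> R" "(g, b) \<in> R" for f g a b
    by (rule R_E[OF that(1)], rule R_E[OF that(2)], rule R_I) (simp_all only: combination_add)
  have mult: "(f * g, a * b) \<in> R" if "(f, a) \<in> R" "(g, b) \<in> R" for f g a b
    by (rule R_E[OF that(1)], rule R_E[OF that(2)], rule R_I)
      (simp_all only: q.combination_mult a.combination_mult)
  obtain \<phi> where "star_hom \<phi>" "\<And>f a. (f, a) \<in> R \<Longrightarrow> \<phi> f = a"
    using star_hom_extension[OF add scale mult star bound dense] by blast
  then show thesis
    using that R_I combination_generators by metis
qed

theorem lemma1p2:
  "relations h0 k0 x0 \<and>
   cstar_generated {h0, k0, x0} = UNIV \<and>
   (\<forall>h k x :: 'a::cstar_algebra. relations h k x \<longrightarrow>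
      (\<exists>!\<phi> :: qC \<Rightarrow> 'a. star_hom \<phi> \<and> \<phi> h0 = h \<and> \<phi> k0 = k \<and> \<phi> x0 = x))"
proof (intro conjI allI impI)
  show "relations h0 k0 x0"
    by (simp add: relations_iff_qC_triple qC_triple_generators)
  show "cstar_generated {h0, k0, x0} = UNIV"
    unfolding cstar_generated_def
  proof (intro hull_unique subset_UNIV)
    show "cstar_subalgebra (UNIV :: qC set)"
      by (simp add: cstar_subalgebra_def)
    fix S :: "qC set"
    assume S: "{h0, k0, x0} \<subseteq> S" "cstar_subalgebra S"
    then have "{f. \<exists>p q r s. f = combination h0 k0 x0 p q r s} \<subseteq> S"
      using combination_in_cstar_subalgebra by auto
    then have "closure {f. \<exists>p q r s. f = combination h0 k0 x0 p q r s} \<subseteq> S"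
      using S(2) by (intro closure_minimal) (auto simp: cstar_subalgebra_def)
    then show "UNIV \<subseteq> S"
      by (simp add: closure_combinations)
  qed
  fix h k x :: 'a
  assume "relations h k x"
  then have "qC_triple h k x"
    by (simp add: relations_iff_qC_triple)
  then obtain \<phi> :: "qC \<Rightarrow> 'a" where \<phi>: "star_hom \<phi>" "\<phi> h0 = h" "\<phi> k0 = k" "\<phi> x0 = x"
    by (rule star_hom_combinations)
  show "\<exists>!\<phi> :: qC \<Rightarrow> 'a. star_hom \<phi> \<and> \<phi> h0 = h \<and> \<phi> k0 = k \<and> \<phi> x0 = x"
  proof (rule ex1I)
    show "star_hom \<phi> \<and> \<phi> h0 = h \<and> \<phi> k0 = k \<and> \<phi> x0 = x"
      using \<phi> by blast
    fix \<psi> :: "qC \<Rightarrow> 'a"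
    assume \<psi>: "star_hom \<psi> \<and> \<psi> h0 = h \<and> \<psi> k0 = k \<and> \<psi> x0 = x"
    \<comment> \<open>Contractivity makes both maps continuous, so agreement passes from the
      combinations to their closure.\<close>
    have "closed {f. \<psi> f = \<phi> f}"
      using \<phi>(1) \<psi> by (intro closed_Collect_eq continuous_on_star_hom) blast+
    moreover have "{f. \<exists>p q r s. f = combination h0 k0 x0 p q r s} \<subseteq> {f. \<psi> f = \<phi> f}"
      using \<phi> \<psi> by (auto simp: combination_star_hom)
    ultimately have "closure {f. \<exists>p q r s. f = combination h0 k0 x0 p q r s} \<subseteq> {f. \<psi> f = \<phi> f}"
      by (rule closure_minimal[rotated])
    then show "\<psi> = \<phi>"
      by (auto simp: closure_combinations fun_eq_iff)
  qed
qed

end
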